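(* Let $A\subset\mathbb{R}^n$ be a smooth set with $|A|>0$ and $|\mathbb{R}^n\setminus A|>0$. Let $\phi:\mathbb{R}^n\to\mathbb{R}^n$ be a bilipschitz $\mathcal{C}^1$ mapping whose Jacobian matrix (differential) $x\mapsto D\phi(x)$ is uniformly continuous on $\mathbb{R}^n$. Fix $0<\alpha<1$. Then the set $$\left\{x\in\mathbb{R}^n:\ \lim_{h\to 0}\frac{|A\cap\phi(Q(x,h))|}{|\phi(Q(x,h))|}=\alpha\right\}$$ has Hausdorff dimension $n$.
   Context: $|\cdot|$ denotes Lebesgue measure in $\mathbb{R}^n$. A cube means a cube in $\mathbb{R}^n$ with sides parallel to the coordinate axes; $l(Q)$ is the sidelength of a cube $Q$. Two cubes $Q,Q'$ with $l(Q)=l(Q')$ are called consecutive if the intersection of their closures is one of their ($(n-1)$-dimensional) faces. For a measurable set $A\subset\mathbb{R}^n$, the density of $A$ in a cube $Q$ is $D(Q)=|A\cap Q|/|Q|$. A measurable set $A\subset\mathbb{R}^n$ is called smooth (in $\mathbb{R}^n$) if $$\lim_{\delta\to 0}\ \sup|D(Q)-D(Q')|=0,$$ where the supremum is taken over all pairs of consecutive cubes $Q,Q'$ with $l(Q)=l(Q')\le\delta$. For $x\in\mathbb{R}^n$ and $h>0$, $Q(x,h)$ denotes the cube centered at $x$ of sidelength $h$. A mapping $\phi:\mathbb{R}^n\to\mathbb{R}^n$ is bilipschitz if there is a constant $C\ge 1$ such that $C^{-1}\|x-y\|\le\|\phi(x)-\phi(y)\|\le C\|x-y\|$ for all $x,y\in\mathbb{R}^n$.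 *)

theory Defs
  imports "HOL-Analysis.Analysis"
begin

text \<open>
  Cubes are taken closed. Whether a cube contains its boundary does not affect any of the measures
  below, since boundaries of cubes, and their images under Lipschitz maps, are null sets.
\<close>

definition cube :: "real ^ 'n \<Rightarrow> real \<Rightarrow> (real ^ 'n) set" where
  "cube x h = cbox (x - vec (h / 2)) (x + vec (h / 2))"

definition consecutive_cubes :: "(real ^ 'n) set \<Rightarrow> (real ^ 'n) set \<Rightarrow> real \<Rightarrow> bool" where
  "consecutive_cubes Q Q' l \<longleftrightarrow>
     l > 0 \<and> (\<exists>x. Q = cube x l) \<and> (\<exists>x. Q' = cube x l) \<and>
     (closure Q \<inter> closure Q') facet_of closure Q \<and>
     (closure Q \<inter> closure Q') facet_of closure Q'"

definition cube_density :: "(real ^ 'n) set \<Rightarrow> (real ^ 'n) set \<Rightarrow> real" where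
  "cube_density A Q = measure lebesgue (A \<inter> Q) / measure lebesgue Q"

text \<open>
  For \<open>\<delta> > 0\<close> the supremum is over a nonempty subset of the unit interval, so the real-valued
  supremum is the intended one; only such \<open>\<delta>\<close> matter in the limit.
\<close>

definition smooth_set :: "(real ^ 'n) set \<Rightarrow> bool" where
  "smooth_set A \<longleftrightarrow>
     A \<in> sets lebesgue \<and>
     ((\<lambda>\<delta>. SUP (Q, Q') \<in> {(Q, Q'). \<exists>l\<le>\<delta>. consecutive_cubes Q Q' l}.
             \<bar>cube_density A Q - cube_density A Q'\<bar>) \<longlongrightarrow> 0) (at_right 0)"

definition bilipschitz :: "('a::real_normed_vector \<Rightarrow> 'b::real_normed_vector) \<Rightarrow> bool" where
  "bilipschitz f \<longleftrightarrow>
     (\<exists>C\<ge>1. \<forall>x y. inverse C * norm (x - y) \<le> norm (f x - f y) \<and>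
                   norm (f x - f y) \<le> C * norm (x - y))"

definition C1_map :: "(real ^ 'n \<Rightarrow> real ^ 'm) \<Rightarrow> bool" where
  "C1_map f \<longleftrightarrow>
     (\<forall>x. f differentiable (at x)) \<and> continuous_on UNIV (\<lambda>x. jacobian f (at x))"

text \<open>
  The \<open>s\<close>-th power of the diameter with the convention \<open>0\<^sup>0 = 1\<close> for nonempty sets (needed for
  \<open>s = 0\<close> to give counting measure; \<open>0 powr 0\<close> is \<open>0\<close>). The empty set always contributes \<open>0\<close>,
  so that sequences of sets also represent finite covers.
\<close>

definition diameter_powr :: "real \<Rightarrow> 'a::metric_space set \<Rightarrow> ennreal" where
  "diameter_powr s U =
     (if U = {} then 0 else if s = 0 then 1 else ennreal (diameter U powr s))"

text \<open>Boundedness is required because \<^const>\<open>diameter\<close> is unspecified on unbounded sets.\<close>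

definition hausdorff_content :: "real \<Rightarrow> real \<Rightarrow> 'a::metric_space set \<Rightarrow> ennreal" where
  "hausdorff_content s \<delta> E =
     Inf {(\<Sum>i. diameter_powr s (U i)) | U :: nat \<Rightarrow> 'a set.
            E \<subseteq> (\<Union>i. U i) \<and> (\<forall>i. bounded (U i) \<and> diameter (U i) \<le> \<delta>)}"

definition hausdorff_measure :: "real \<Rightarrow> 'a::metric_space set \<Rightarrow> ennreal" where
  "hausdorff_measure s E = (SUP \<delta>\<in>{0<..}. hausdorff_content s \<delta> E)"

definition hausdorff_dim :: "'a::metric_space set \<Rightarrow> ennreal" where
  "hausdorff_dim E = Inf {ennreal s | s. s \<ge> 0 \<and> hausdorff_measure s E = 0}"

end

theory Submission
  imports Defs
begin

text \<open>
  Writing \<open>\<phi>(Q(x, h))\<close> up to a thin boundary layer as a union of dyadic cubes much smaller than \<open>h\<close>,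
  whose densities all nearly agree because \<open>A\<close> is smooth, one sees that the density of \<open>A\<close> in
  \<open>\<phi>(Q(x, h))\<close> differs by \<open>o(1)\<close> from its density in a dyadic cube of side about \<open>h\<close> whose closure
  contains \<open>\<phi>(x)\<close>. As \<open>\<phi>\<close> is onto by invariance of domain and bilipschitz, it suffices to show
  that the points along which the dyadic densities tend to \<open>\<alpha>\<close> have dimension \<open>n\<close>.

  From a cube \<open>Q\<close> with density near \<open>\<alpha>\<close>, follow the martingale of dyadic densities until it crosses
  \<open>\<alpha>\<close> and goes slightly beyond, or moves equally far in the opposite direction. The stopped cubes of
  the first kind fill at least a quarter of \<open>Q\<close>, and since the martingale has small steps
  they are much smaller than \<open>Q\<close>. Iterating with shrinking excursions gives a tree of cubes whose
  branches have dyadic densities tending to \<open>\<alpha>\<close>. Such a tree defeats every cover with small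
  \<open>s\<close>-dimensional sum, \<open>s < n\<close>: one descends greedily, keeping the part of the cover that meets the
  current cube small relative to the cube.
\<close>

subsection \<open>Dyadic cubes\<close>

text \<open>Each generation of the tree keeps only a quarter of the volume, a loss that does not
  tend to 0. It is affordable because the children can be made 2^-N times smaller than their parent
  for any fixed N, which reduces the loss of dimension to order 1 / N. No uniform lower bound for
  the size of a child is available, so dimension formulas for homogeneous Cantor sets do not apply;
  hence the direct fight against a given cover, without a measure on the limit set. The excursion
  goes through \<alpha> to the other side, instead of stopping near \<alpha>, for two reasons. Its
  length is then bounded below even if the parent has density exactly \<alpha>, so it lasts many
  generations. And the child ends at a distance from \<alpha> governed by the small excess of the
  excursion alone, whatever the deviation of the parent was, so errors do not accumulate along a
  branch.\<close>

definition grid_index :: "nat \<Rightarrow> real ^ 'n \<Rightarrow> int ^ 'n" where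
  "grid_index k x = (\<chi> j. \<lfloor>2 ^ k * x $ j\<rfloor>)"

text \<open>
  Half-open dyadic cubes are the fibres of \<open>grid_index k\<close>, so that nesting and disjointness
  reduce to arithmetic of integer parts.
\<close>

definition dyadic :: "nat \<Rightarrow> int ^ 'n \<Rightarrow> (real ^ 'n) set" where
  "dyadic k i = {x. grid_index k x = i}"

text \<open>Compact, so that nested sequences have a common point, and literally a
  \<open>cube\<close>, the notion to which smoothness refers.\<close>

definition dyadic_box :: "nat \<Rightarrow> int ^ 'n \<Rightarrow> (real ^ 'n) set" where
  "dyadic_box k i = cbox (\<chi> j. of_int (i $ j) / 2 ^ k) (\<chi> j. (of_int (i $ j) + 1) / 2 ^ k)"

definition dyadic_vol :: "'n::finite itself \<Rightarrow> nat \<Rightarrow> real" where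
  "dyadic_vol _ k = (1 / 2 ^ k) ^ CARD('n)"

definition dyadic_density :: "(real ^ 'n) set \<Rightarrow> nat \<Rightarrow> int ^ 'n \<Rightarrow> real" where
  "dyadic_density A k i = measure lebesgue (A \<inter> dyadic k i) / dyadic_vol TYPE('n) k"

lemma dyadic_vol_pos: "dyadic_vol TYPE('n::finite) k > 0"
  by (simp add: dyadic_vol_def)

lemma mem_dyadic_index [simp]: "x \<in> dyadic k (grid_index k x)"
  by (simp add: dyadic_def)

lemma dyadic_disjoint: "i \<noteq> j \<Longrightarrow> dyadic k i \<inter> dyadic k j = {}"
  by (auto simp: dyadic_def)

lemma mem_dyadic:
  "x \<in> dyadic k i \<longleftrightarrow> (\<forall>j. of_int (i $ j) \<le> 2 ^ k * x $ j \<and> 2 ^ k * x $ j < of_int (i $ j) + 1)"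
  by (simp add: dyadic_def grid_index_def vec_eq_iff floor_eq_iff)

lemma mem_dyadic_box:
  "x \<in> dyadic_box k i \<longleftrightarrow> (\<forall>j. of_int (i $ j) \<le> 2 ^ k * x $ j \<and> 2 ^ k * x $ j \<le> of_int (i $ j) + 1)"
  by (simp add: dyadic_box_def mem_box_cart field_simps)

lemma dyadic_subset_box: "dyadic k i \<subseteq> dyadic_box k i"
  by (auto simp: mem_dyadic mem_dyadic_box less_imp_le)

lemma measure_lebesgue_cbox_cart:
  fixes a b :: "real ^ 'n"
  assumes "\<And>j. a $ j \<le> b $ j"
  shows "measure lebesgue (cbox a b) = (\<Prod>j\<in>UNIV. b $ j - a $ j)"
  using content_cbox_cart[of a b] assms by (simp add: interval_ne_empty_cart measure_completion)

lemma measure_dyadic_box: "measure lebesgue (dyadic_box k i) = dyadic_vol TYPE('n) k"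
  for i :: "int ^ 'n"
proof -
  have "(of_int (i $ j) + 1) / 2 ^ k - of_int (i $ j) / 2 ^ k = 1 / (2::real) ^ k" for j
    by (simp add: field_simps)
  then show ?thesis
    unfolding dyadic_box_def dyadic_vol_def
    by (subst measure_lebesgue_cbox_cart) (auto simp: divide_right_mono)
qed

lemma negligible_dyadic_box_diff: fixes i :: "int ^ 'a" shows "negligible (dyadic_box k i - dyadic k i)"
proof -
  let ?a = "(\<chi> j. of_int (i $ j) / 2 ^ k) :: real ^ 'a" and ?b = "(\<chi> j. (of_int (i $ j) + 1) / 2 ^ k) :: real ^ 'a"
  have "box ?a ?b \<subseteq> dyadic k i"
    unfolding subset_iff mem_dyadic by (auto simp: mem_box_cart field_simps less_imp_le)
  then show ?thesis
    using negligible_frontier_interval[of ?a ?b]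
    by (elim negligible_subset) (auto simp: dyadic_box_def)
qed

lemma dyadic_lmeasurable [simp, intro]: "dyadic k i \<in> lmeasurable"
proof -
  have "dyadic_box k i \<in> lmeasurable"
    by (simp add: dyadic_box_def)
  from fmeasurable.Diff[OF this negligible_imp_measurable[OF negligible_dyadic_box_diff[of k i]]]
  have "dyadic_box k i - (dyadic_box k i - dyadic k i) \<in> lmeasurable" .
  moreover have "dyadic_box k i - (dyadic_box k i - dyadic k i) = dyadic k i"
    using dyadic_subset_box[of k i] by blast
  ultimately show ?thesis by simp
qed

lemma sets_dyadic [simp, intro]: "dyadic k i \<in> sets lebesgue"
  by (simp add: fmeasurableD)

lemma lmeasurable_Int_dyadic [simp, intro]:
  "A \<in> sets lebesgue \<Longrightarrow> A \<inter> dyadic k i \<in> lmeasurable"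
  using fmeasurable_Int_fmeasurable[OF dyadic_lmeasurable, of A] by (simp add: Int_commute)

lemma measure_Int_dyadic_box:
  assumes "A \<in> sets lebesgue"
  shows "measure lebesgue (A \<inter> dyadic_box k i) = measure lebesgue (A \<inter> dyadic k i)"
proof -
  have "negligible (A \<inter> dyadic_box k i - A \<inter> dyadic k i)"
    by (rule negligible_subset[OF negligible_dyadic_box_diff[of k i]]) auto
  then have *: "negligible ((A \<inter> dyadic k i - A \<inter> dyadic_box k i) \<union> (A \<inter> dyadic_box k i - A \<inter> dyadic k i))"
    using dyadic_subset_box[of k i] by (simp add: Diff_Int_distrib Int_absorb1 Diff_eq_empty_iff[THEN iffD2] le_infI2)
  show ?thesis
    using assms by (intro measure_negligible_symdiff[OF _ *]) auto
qed

lemma measure_dyadic: "measure lebesgue (dyadic k i) = dyadic_vol TYPE('n) k" for i :: "int ^ 'n"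
  using measure_Int_dyadic_box[of UNIV k i] by (simp add: measure_dyadic_box)

lemma grid_index_coarser:
  "grid_index k x $ j = grid_index (k + p) x $ j div 2 ^ p"
  using floor_divide_real_eq_div[of "2 ^ p" "2 ^ (k + p) * x $ j"]
  by (simp add: grid_index_def power_add)

lemma grid_index_mono:
  assumes "grid_index l x = grid_index l y" "k \<le> l"
  shows "grid_index k x = grid_index k y"
  proof -
  have "grid_index k z $ j = grid_index l z $ j div 2 ^ (l - k)" for z :: "real ^ 'a" and j
    using grid_index_coarser[of k z j "l - k"] assms(2) by simp
  then show ?thesis
    using assms(1) by (simp only: vec_eq_iff) simp
qed

lemma dyadic_nested:
  assumes "k \<le> l" "x \<in> dyadic l i"
  shows "dyadic l i \<subseteq> dyadic k (grid_index k x)"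
  using assms grid_index_mono by (force simp: dyadic_def)

lemma closure_dyadic: fixes i :: "int ^ 'a" shows "closure (dyadic k i) = dyadic_box k i"
proof
  show "closure (dyadic k i) \<subseteq> dyadic_box k i"
    using dyadic_subset_box by (intro closure_minimal) (auto simp: dyadic_box_def)
  let ?a = "(\<chi> j. of_int (i $ j) / 2 ^ k) :: real ^ 'a" and ?b = "(\<chi> j. (of_int (i $ j) + 1) / 2 ^ k) :: real ^ 'a"
  have "box ?a ?b \<subseteq> dyadic k i"
    unfolding subset_iff mem_dyadic by (auto simp: mem_box_cart field_simps less_imp_le)
  moreover have "box ?a ?b \<noteq> {}"
    by (simp add: interval_ne_empty_cart divide_strict_right_mono)
  ultimately show "dyadic_box k i \<subseteq> closure (dyadic k i)"
    using closure_mono[of "box ?a ?b" "dyadic k i"] by (simp add: dyadic_box_def)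
qed

lemma dyadic_box_mono: "dyadic l i \<subseteq> dyadic k j \<Longrightarrow> dyadic_box l i \<subseteq> dyadic_box k j"
  using closure_mono closure_dyadic by metis

lemma dyadic_nonempty: "dyadic k i \<noteq> {}"
proof -
  have "(\<chi> j. of_int (i $ j) / 2 ^ k) \<in> dyadic k i"
    by (simp add: mem_dyadic)
  then show ?thesis by blast
qed

lemma dyadic_density_Compl:
  assumes "A \<in> sets lebesgue"
  shows "dyadic_density (- A) k i = 1 - dyadic_density A k i"
proof -
  have "measure lebesgue (dyadic k i - A \<inter> dyadic k i) = measure lebesgue (dyadic k i) - measure lebesgue (A \<inter> dyadic k i)"
    using assms by (intro measurable_measure_Diff) auto
  moreover have "dyadic k i - A \<inter> dyadic k i = - A \<inter> dyadic k i" by auto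
  ultimately show ?thesis
    using dyadic_vol_pos[where 'n='a and k=k] by (simp add: dyadic_density_def measure_dyadic field_simps)
qed

lemma dyadic_density_bounds:
  assumes "A \<in> sets lebesgue"
  shows "0 \<le> dyadic_density A k i" "dyadic_density A k i \<le> 1"
proof -
  show "0 \<le> dyadic_density A k i" for A :: "(real^'a) set"
    using dyadic_vol_pos[where 'n='a and k=k] by (simp add: dyadic_density_def)
  from this[of "- A"] show "dyadic_density A k i \<le> 1"
    using assms by (simp add: dyadic_density_Compl)
qed

text \<open>Membership in the sigma-algebra of generation k of the dyadic filtration. Phrased by
  points, it handles stopping sets without listing their cubes.\<close>

definition saturated :: "nat \<Rightarrow> (real ^ 'n) set \<Rightarrow> bool" where
  "saturated k S \<longleftrightarrow> (\<forall>x y. grid_index k x = grid_index k y \<longrightarrow> x \<in> S \<longrightarrow> y \<in> S)"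

lemma saturated_eq_Union: "saturated k S \<Longrightarrow> (\<Union>i\<in>grid_index k ` S. dyadic k i) = S"
  unfolding saturated_def dyadic_def by (simp add: set_eq_iff) metis

lemma finite_grid_index_image:
  fixes S :: "(real ^ 'n) set"
  assumes "bounded S"
  shows "finite (grid_index k ` S)"
proof -
  obtain B where B: "\<And>x. x \<in> S \<Longrightarrow> norm x \<le> B"
    using assms bounded_iff by blast
  let ?m = "\<lceil>2 ^ k * B\<rceil> + 1"
  have "vec_nth (grid_index k x) \<in> UNIV \<rightarrow>\<^sub>E {- ?m..?m}" if "x \<in> S" for x
  proof -
    have "\<lfloor>2 ^ k * x $ j\<rfloor> \<in> {- ?m..?m}" for j
    proof -
      have "\<bar>2 ^ k * x $ j\<bar> \<le> 2 ^ k * B"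
        using B[OF that] component_le_norm_cart[of x j] by (simp add: abs_mult)
      then show ?thesis by simp linarith
    qed
    then show ?thesis by (simp add: grid_index_def PiE_def Pi_def)
  qed
  then have "vec_nth ` grid_index k ` S \<subseteq> UNIV \<rightarrow>\<^sub>E {- ?m..?m}" by blast
  then have "finite (vec_nth ` grid_index k ` S)"
    by (rule finite_subset) (simp add: finite_PiE)
  then show ?thesis
    by (rule finite_imageD) (simp add: inj_on_def vec_nth_inject)
qed

lemma saturated_lmeasurable:
  assumes "saturated k S" "bounded S"
  shows "S \<in> lmeasurable"
proof -
  have "(\<Union>i\<in>grid_index k ` S. dyadic k i) \<in> lmeasurable"
    by (rule fmeasurable.finite_UN) (auto simp: finite_grid_index_image[OF assms(2)])
  then show ?thesis
    by (simp only: saturated_eq_Union[OF assms(1)])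
qed

section \<open>Averages of densities over unions of cubes of one generation\<close>

lemma measure_Int_saturated:
  fixes S :: "(real ^ 'n) set"
  assumes "saturated k S" "bounded S" "A \<in> sets lebesgue"
  shows "measure lebesgue (A \<inter> S) = (\<Sum>i\<in>grid_index k ` S. dyadic_density A k i) * dyadic_vol TYPE('n) k"
proof -
  have "measure lebesgue (A \<inter> S) = measure lebesgue (\<Union>i\<in>grid_index k ` S. A \<inter> dyadic k i)"
    by (simp only: saturated_eq_Union[OF assms(1)] Int_UN_distrib[symmetric])
  also have "\<dots> = (\<Sum>i\<in>grid_index k ` S. measure lebesgue (A \<inter> dyadic k i))"
    using assms(3) finite_grid_index_image[OF assms(2)]
    by (intro measure_UNION') (auto simp: pairwise_def disjnt_def dest: dyadic_disjoint)
  finally show ?thesis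
    using dyadic_vol_pos[where 'n='n and k=k]
    by (simp add: dyadic_density_def sum_divide_distrib[symmetric])
qed

lemma measure_saturated:
  fixes S :: "(real ^ 'n) set"
  assumes "saturated k S" "bounded S"
  shows "measure lebesgue S = card (grid_index k ` S) * dyadic_vol TYPE('n) k"
  using measure_Int_saturated[OF assms, of UNIV] dyadic_vol_pos[where 'n='n and k=k]
  by (simp add: dyadic_density_def measure_dyadic)

lemma measure_Int_saturated_le:
  fixes S :: "(real ^ 'n) set"
  assumes "saturated k S" "bounded S" "A \<in> sets lebesgue"
    and "\<And>x. x \<in> S \<Longrightarrow> dyadic_density A k (grid_index k x) \<le> b"
  shows "measure lebesgue (A \<inter> S) \<le> b * measure lebesgue S"
proof -
  have "(\<Sum>i\<in>grid_index k ` S. dyadic_density A k i) \<le> (\<Sum>i\<in>grid_index k ` S. b)"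
    by (intro sum_mono) (use assms(4) in auto)
  then show ?thesis
    using dyadic_vol_pos[where 'n='n and k=k]
    by (simp add: measure_Int_saturated[OF assms(1-3)] measure_saturated[OF assms(1,2)] mult.assoc[symmetric] mult.commute)
qed

lemma measure_Int_saturated_ge:
  fixes S :: "(real ^ 'n) set"
  assumes "saturated k S" "bounded S" "A \<in> sets lebesgue"
    and "\<And>x. x \<in> S \<Longrightarrow> b \<le> dyadic_density A k (grid_index k x)"
  shows "b * measure lebesgue S \<le> measure lebesgue (A \<inter> S)"
proof -
  have "(\<Sum>i\<in>grid_index k ` S. b) \<le> (\<Sum>i\<in>grid_index k ` S. dyadic_density A k i)"
    by (intro sum_mono) (use assms(4) in auto)
  then show ?thesis
    using dyadic_vol_pos[where 'n='n and k=k]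
    by (simp add: measure_Int_saturated[OF assms(1-3)] measure_saturated[OF assms(1,2)] mult.assoc[symmetric] mult.commute)
qed

lemma fmeasurable_Int_sets: "A \<in> sets M \<Longrightarrow> S \<in> fmeasurable M \<Longrightarrow> A \<inter> S \<in> fmeasurable M"
  using fmeasurable_Int_fmeasurable[of S M A] by (simp add: Int_commute)

lemma measure_Un_disjoint:
  "S \<in> fmeasurable M \<Longrightarrow> T \<in> fmeasurable M \<Longrightarrow> S \<inter> T = {} \<Longrightarrow> measure M (S \<union> T) = measure M S + measure M T"
  using measure_Un2[of S M T] by (simp add: Diff_triv Int_commute)

lemma dyadic_box_component_diff:
  assumes "x \<in> dyadic_box k i" "y \<in> dyadic_box k i"
  shows "\<bar>x $ j - y $ j\<bar> \<le> 1 / 2 ^ k"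
proof -
  have "2 ^ k * x $ j - 2 ^ k * y $ j \<le> 1" "2 ^ k * y $ j - 2 ^ k * x $ j \<le> 1"
    using assms by (smt (verit) mem_dyadic_box)+
  then have "2 ^ k * \<bar>x $ j - y $ j\<bar> \<le> 1"
    by (simp add: abs_if algebra_simps)
  then show ?thesis by (simp add: field_simps)
qed

lemma norm_le_CARD_mult:
  fixes x :: "real ^ 'n"
  assumes "\<And>j. \<bar>x $ j\<bar> \<le> (b::real)"
  shows "norm x \<le> real CARD('n) * b"
proof -
  have "norm x \<le> (\<Sum>j\<in>UNIV. \<bar>x $ j\<bar>)" by (rule norm_le_l1_cart)
  also have "\<dots> \<le> real CARD('n) * b"
    using sum_bounded_above[of UNIV "\<lambda>j. \<bar>x $ j\<bar>" b] assms by simp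
  finally show ?thesis .
qed

lemma dist_dyadic_box_le:
  fixes x y :: "real ^ 'n"
  assumes "x \<in> dyadic_box k i" "y \<in> dyadic_box k i"
  shows "dist x y \<le> real CARD('n) / 2 ^ k"
  using norm_le_CARD_mult[of "x - y" "1 / 2 ^ k"] dyadic_box_component_diff[OF assms]
  by (simp add: dist_norm)

lemma dist_dyadic_le:
  fixes x y :: "real ^ 'n"
  assumes "grid_index k x = grid_index k y"
  shows "dist x y \<le> real CARD('n) / 2 ^ k"
proof (rule dist_dyadic_box_le)
  show "x \<in> dyadic_box k (grid_index k x)" "y \<in> dyadic_box k (grid_index k x)"
    using dyadic_subset_box[of k "grid_index k x"] assms by (auto simp: dyadic_def)
qed

lemma eventually_divide_power2_less:
  fixes c e :: real
  assumes "e > 0"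
  shows "\<forall>\<^sub>F k in sequentially. c / 2 ^ k < e"
proof -
  have "(\<lambda>k. c * inverse ((2::real) ^ k)) \<longlonglongrightarrow> c * 0"
    by (intro tendsto_intros LIMSEQ_inverse_realpow_zero) auto
  then show ?thesis
    using assms by (auto simp: divide_inverse elim: order_tendstoD)
qed

lemma bounded_dyadic: "bounded (dyadic k i)"
  by (rule bounded_subset[OF _ dyadic_subset_box]) (simp add: dyadic_box_def)

lemma dyadic_in_open:
  fixes x :: "real ^ 'n"
  assumes "open S" "x \<in> S"
  shows "\<forall>\<^sub>F k in sequentially. dyadic k (grid_index k x) \<subseteq> S"
proof -
  obtain e where e: "e > 0" "ball x e \<subseteq> S"
    using assms openE by blast
  show ?thesis
    using eventually_divide_power2_less[OF e(1), of "CARD('n)"]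
  proof eventually_elim
    case (elim k)
    then have "dist x y < e" if "grid_index k y = grid_index k x" for y
      using dist_dyadic_le[of k x y] that by simp
    then show ?case using e(2) by (auto simp: dyadic_def)
  qed
qed

subsection \<open>Stopping times on dyadic cubes\<close>

text \<open>Level set of a stopping time for the dyadic filtration, the clock starting at k0.
  Membership is decided by the generations up to k, so this is a union of cubes of generation
  k.\<close>

definition first_hit :: "(nat \<Rightarrow> int ^ 'n \<Rightarrow> bool) \<Rightarrow> nat \<Rightarrow> nat \<Rightarrow> (real ^ 'n) set" where
  "first_hit p k0 k =
     {x. k0 \<le> k \<and> p k (grid_index k x) \<and> (\<forall>l. k0 \<le> l \<and> l < k \<longrightarrow> \<not> p l (grid_index l x))}"

lemma saturated_first_hit: "saturated k (first_hit p k0 k)"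
  unfolding saturated_def
proof (intro allI impI)
  fix x y :: "real ^ 'a"
  assume eq: "grid_index k x = grid_index k y" and x: "x \<in> first_hit p k0 k"
  have "grid_index l x = grid_index l y" if "l \<le> k" for l
    using grid_index_mono[OF eq that] .
  then show "y \<in> first_hit p k0 k"
    using x by (simp add: first_hit_def)
qed

lemma first_hit_disjoint: "k \<noteq> l \<Longrightarrow> first_hit p k0 k \<inter> first_hit p k0 l = {}"
  using linorder_neq_iff[of k l] by (auto simp: first_hit_def)

lemma first_hit_exists:
  assumes "p k (grid_index k x)" "k0 \<le> k"
  shows "\<exists>k. x \<in> first_hit p k0 k"
proof -
  let ?P = "\<lambda>k. k0 \<le> k \<and> p k (grid_index k x)"
  have "?P (LEAST k. ?P k)" by (rule LeastI[of ?P k]) (use assms in auto)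
  moreover have "\<not> ?P l" if "l < (LEAST k. ?P k)" for l
    using not_less_Least[OF that] .
  ultimately show ?thesis unfolding first_hit_def by blast
qed

lemma saturated_Int: "saturated k S \<Longrightarrow> saturated k T \<Longrightarrow> saturated k (S \<inter> T)"
  unfolding saturated_def by blast

lemma saturated_Collect: "saturated k {x. P (grid_index k x)}"
  by (simp add: saturated_def)

lemma saturated_dyadic: "k \<le> l \<Longrightarrow> saturated l (dyadic k i)"
  using grid_index_mono unfolding saturated_def dyadic_def by (metis mem_Collect_eq)

text \<open>
  This replaces the Lebesgue density theorem: cover \<open>A \<inter> Z\<close> tightly by an open set and split the
  latter into its maximal dyadic cubes; those meeting \<open>A \<inter> Z\<close> are filled by \<open>A\<close> in proportion at
  most \<open>b\<close>, so \<open>\<bar>A \<inter> Z\<bar> \<le> b \<bar>A \<inter> Z\<bar>\<close>.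
\<close>

lemma negligible_if_dyadic_density_le:
  fixes A Z :: "(real ^ 'n) set"
  assumes A: "A \<in> sets lebesgue" and Z: "Z \<in> sets lebesgue" "bounded Z" and b: "b < 1"
    and le: "\<And>x k. x \<in> Z \<Longrightarrow> k0 \<le> k \<Longrightarrow> dyadic_density A k (grid_index k x) \<le> b"
  shows "measure lebesgue (A \<inter> Z) = 0"
proof -
  \<comment> \<open>b may be negative; a nonnegative factor is needed to multiply inequalities
    between measures.\<close>
  define c where "c = max b 0"
  have c: "0 \<le> c" "c < 1" "b \<le> c" using b by (auto simp: c_def)
  define T where "T = A \<inter> Z"
  have T: "T \<in> lmeasurable"
    using A Z bounded_set_imp_lmeasurable[of T] bounded_subset[of Z T] by (auto simp: T_def)
  have "measure lebesgue T \<le> c * (measure lebesgue T + e)" if "e > 0" for e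
  proof -
    obtain U where U: "open U" "T \<subseteq> U" "U - T \<in> lmeasurable" "emeasure lebesgue (U - T) < ennreal e"
      using sets_lebesgue_outer_open[OF fmeasurableD[OF T] \<open>e > 0\<close>] by metis
    obtain R where R: "Z \<subseteq> ball 0 R"
      using Z(2) bounded_subset_ballD by blast
    define V where "V = U \<inter> ball 0 R"
    have V: "open V" "T \<subseteq> V" "bounded V" "V \<in> lmeasurable"
      using U(1,2) R by (auto simp: V_def T_def bounded_Int intro!: lmeasurable_open)
    have "measure lebesgue V \<le> measure lebesgue (T \<union> (U - T))"
      using fmeasurable.Un[OF T U(3)] V(4) by (intro measure_mono_fmeasurable) (auto simp: V_def)
    also have "\<dots> \<le> measure lebesgue T + measure lebesgue (U - T)"
      using T U(3) by (intro measure_Un_le) auto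
    also have "measure lebesgue (U - T) \<le> e"
      using U(3,4) \<open>e > 0\<close> by (simp add: emeasure_eq_measure2 ennreal_less_iff)
    finally have mV: "measure lebesgue V \<le> measure lebesgue T + e" by simp
    \<comment> \<open>Asking the cube to meet T supplies a point of Z in it, where \<open>le\<close>
      applies; the density is the same at all points of the cube.\<close>
    define p where "p k i \<longleftrightarrow> dyadic k i \<subseteq> V \<and> dyadic k i \<inter> T \<noteq> {}" for k and i :: "int ^ 'n"
    define G where "G = first_hit p k0"
    have GV: "G k \<subseteq> V" for k
    proof
      fix x assume "x \<in> G k"
      then have "dyadic k (grid_index k x) \<subseteq> V" by (simp add: G_def first_hit_def p_def)
      then show "x \<in> V" using mem_dyadic_index by blast
    qed
    have G: "saturated k (G k)" "bounded (G k)" "G k \<in> lmeasurable" for k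
      using saturated_first_hit[of k p k0] bounded_subset[OF V(3) GV] saturated_lmeasurable
      by (auto simp: G_def)
    have AG: "measure lebesgue (A \<inter> G k) \<le> b * measure lebesgue (G k)" for k
    proof (rule measure_Int_saturated_le[OF G(1,2) A])
      fix x assume "x \<in> G k"
      then obtain z where "z \<in> T" "grid_index k z = grid_index k x" "k0 \<le> k"
        by (auto simp: G_def first_hit_def p_def dyadic_def)
      then show "dyadic_density A k (grid_index k x) \<le> b"
        using le[of z k] by (simp add: T_def)
    qed
    have TG: "T \<subseteq> (\<Union>k. G k)"
    proof
      fix x assume x: "x \<in> T"
      have "\<forall>\<^sub>F k in sequentially. dyadic k (grid_index k x) \<subseteq> V \<and> k0 \<le> k"
        using dyadic_in_open[OF V(1), of x] x V(2) by (intro eventually_conj eventually_ge_at_top) auto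
      then obtain k where "dyadic k (grid_index k x) \<subseteq> V" "k0 \<le> k"
        using eventually_happens'[OF sequentially_bot] by blast
      then show "x \<in> (\<Union>k. G k)"
        using first_hit_exists[of p k x k0] x by (force simp: p_def G_def)
    qed
    have fin: "measure lebesgue (T \<inter> (\<Union>k<M. G k)) \<le> c * measure lebesgue V" for M
    proof -
      have "measure lebesgue (T \<inter> (\<Union>k<M. G k)) \<le> measure lebesgue (\<Union>k<M. A \<inter> G k)"
      proof (rule measure_mono_fmeasurable)
        show "(\<Union>k<M. A \<inter> G k) \<in> lmeasurable"
          using fmeasurable_Int_sets[OF A G(3)] by (intro fmeasurable.finite_UN) auto
      qed (use T G(3) in \<open>auto simp: T_def\<close>)
      also have "\<dots> \<le> (\<Sum>k<M. measure lebesgue (A \<inter> G k))"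
        using A G(3) by (intro measure_UNION_le) auto
      also have "\<dots> \<le> (\<Sum>k<M. c * measure lebesgue (G k))"
        using AG c(3) by (intro sum_mono) (meson measure_nonneg mult_right_mono order_trans)
      also have "\<dots> = c * measure lebesgue (\<Union>k<M. G k)"
        using G(3) first_hit_disjoint[of _ _ p k0]
        by (subst measure_UNION') (simp_all add: G_def pairwise_def disjnt_def sum_distrib_left)
      also have "\<dots> \<le> c * measure lebesgue V"
        using c G(3) V(4) GV by (intro mult_left_mono measure_mono_fmeasurable) auto
      finally show ?thesis .
    qed
    have "(\<lambda>M. measure lebesgue (T \<inter> (\<Union>k<M. G k))) \<longlonglongrightarrow> measure lebesgue (\<Union>M. T \<inter> (\<Union>k<M. G k))"
    proof (rule Lim_measure_incseq)
      show "range (\<lambda>M. T \<inter> (\<Union>k<M. G k)) \<subseteq> sets lebesgue"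
        using T G(3) by auto
      show "incseq (\<lambda>M. T \<inter> (\<Union>k<M. G k))"
        by (force simp: incseq_def)
      have "(\<Union>M. T \<inter> (\<Union>k<M. G k)) = T" using TG by fastforce
      then show "emeasure lebesgue (\<Union>M. T \<inter> (\<Union>k<M. G k)) \<noteq> \<infinity>"
        using fmeasurableD2[OF T] by simp
    qed
    moreover have "(\<Union>M. T \<inter> (\<Union>k<M. G k)) = T" using TG by fastforce
    ultimately have "measure lebesgue T \<le> c * measure lebesgue V"
      using fin by (intro LIMSEQ_le_const2) auto
    also have "\<dots> \<le> c * (measure lebesgue T + e)"
      using mV c by (intro mult_left_mono)
    finally show ?thesis .
  qed
  then have "measure lebesgue T \<le> c * measure lebesgue T + e" if "e > 0" for e
    using that c by (smt (verit) distrib_left mult_left_le_one_le)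
  then have "measure lebesgue T \<le> c * measure lebesgue T"
    by (rule field_le_epsilon)
  then have "(1 - c) * measure lebesgue T \<le> 0" by (simp add: algebra_simps)
  then show ?thesis
    using c by (simp add: mult_le_0_iff T_def measure_le_0_iff)
qed

text \<open>
  The dyadic density is a martingale with steps at most \<open>\<eta>\<close> and limits \<open>0\<close> or \<open>1\<close> almost
  everywhere. Stopped on leaving \<open>(D - t, D + t)\<close>, it exits downwards on at least \<open>t / (2 t + \<eta>)\<close>,
  that is one third, of the cube; a quarter remains after passing to a finite subfamily.
\<close>

lemma stopping_family_down:
  fixes A :: "(real ^ 'n) set" and k :: nat and i :: "int ^ 'n"
  defines "D \<equiv> dyadic_density A k i"
  assumes A: "A \<in> sets lebesgue"
    and jump: "\<And>m x. k \<le> m \<Longrightarrow>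
      \<bar>dyadic_density A (Suc m) (grid_index (Suc m) x) - dyadic_density A m (grid_index m x)\<bar> \<le> \<eta>"
    and t: "0 < \<eta>" "\<eta> \<le> t" "0 < D - t" "D + t < 1"
  obtains F :: "(nat \<times> (int ^ 'n)) set" where
    "finite F"
    "\<And>q q'. q \<in> F \<Longrightarrow> q' \<in> F \<Longrightarrow> q \<noteq> q' \<Longrightarrow> dyadic (fst q) (snd q) \<inter> dyadic (fst q') (snd q') = {}"
    "\<And>m j. (m, j) \<in> F \<Longrightarrow> k \<le> m \<and> t \<le> real (m - k) * \<eta> \<and> dyadic m j \<subseteq> dyadic k i \<and>
       D - t - \<eta> \<le> dyadic_density A m j \<and> dyadic_density A m j \<le> D - t \<and>
       (\<forall>l. k \<le> l \<and> l \<le> m \<longrightarrow>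
         (\<exists>i'. dyadic m j \<subseteq> dyadic l i' \<and> \<bar>dyadic_density A l i' - D\<bar> \<le> t + \<eta>))"
    "dyadic_vol TYPE('n) k \<le> 4 * (\<Sum>q\<in>F. dyadic_vol TYPE('n) (fst q))"
proof -
  let ?d = "\<lambda>m x. dyadic_density A m (grid_index m x)"
  let ?v = "dyadic_vol TYPE('n)"
  define p where "p m j \<longleftrightarrow> t \<le> \<bar>dyadic_density A m j - D\<bar>" for m and j :: "int ^ 'n"
  define G where "G m = dyadic k i \<inter> first_hit p k m" for m
  define V where "V m = G m \<inter> {x. ?d m x \<le> D - t}" for m
  define W where "W m = G m \<inter> {x. ?d m x \<ge> D + t}" for m
  have Gk: "k \<le> m" if "x \<in> G m" for x m
    using that by (simp add: G_def first_hit_def)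
  have satG: "saturated m (G m)" for m
  proof (cases "k \<le> m")
    case True
    then show ?thesis
      unfolding G_def by (intro saturated_Int saturated_first_hit saturated_dyadic)
  next
    case False
    then have "G m = {}" using Gk by blast
    then show ?thesis by (simp add: saturated_def)
  qed
  have satVW: "saturated m (V m)" "saturated m (W m)" for m
    unfolding V_def W_def by (intro saturated_Int satG saturated_Collect)+
  have sub: "G m \<subseteq> dyadic k i" "V m \<subseteq> dyadic k i" "W m \<subseteq> dyadic k i" for m
    by (auto simp: G_def V_def W_def)
  have bdd: "bounded (G m)" "bounded (V m)" "bounded (W m)" for m
    by (intro bounded_subset[OF bounded_dyadic sub(1)] bounded_subset[OF bounded_dyadic sub(2)]
        bounded_subset[OF bounded_dyadic sub(3)])+
  have lm: "G m \<in> lmeasurable" "V m \<in> lmeasurable" "W m \<in> lmeasurable" for m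
    by (rule saturated_lmeasurable[OF satG bdd(1)] saturated_lmeasurable[OF satVW(1) bdd(2)]
        saturated_lmeasurable[OF satVW(2) bdd(3)])+
  have disj: "G m \<inter> G m' = {}" if "m \<noteq> m'" for m m'
    using first_hit_disjoint[OF that, of p k] by (auto simp: G_def)
  have dQ: "?d k x = D" if "x \<in> dyadic k i" for x
    using that by (simp add: D_def dyadic_def)
  have before: "\<bar>?d l x - D\<bar> < t" if "x \<in> G m" "k \<le> l" "l < m" for x l m
    using that by (auto simp: G_def first_hit_def p_def)
  have Gm: "k < m" if "x \<in> G m" for x m
  proof (rule ccontr)
    assume "\<not> k < m"
    then have "m = k" using Gk[OF that] by simp
    moreover have "t \<le> \<bar>?d m x - D\<bar>" using that by (simp add: G_def first_hit_def p_def)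
    moreover have "x \<in> dyadic k i" using that sub(1)[of m] by blast
    ultimately show False using dQ[of x] t by simp
  qed
  \<comment> \<open>One generation before stopping the deviation is still below t, so the overshoot
    is at most a single step.\<close>
  have at: "\<bar>?d m x - D\<bar> \<le> t + \<eta>" if x: "x \<in> G m" for x m
  proof -
    have "k < m" using Gm x .
    then obtain l where l: "m = Suc l" "k \<le> l" by (cases m) auto
    then show ?thesis using before[OF x, of l] jump[of l x] by auto
  qed
  have steps: "\<bar>?d (k + r) x - D\<bar> \<le> real r * \<eta>" if "x \<in> dyadic k i" for x r
  proof (induction r)
    case 0
    then show ?case using dQ[OF that] by simp
  next
    case (Suc r)
    then show ?case using jump[of "k + r" x] by (simp add: algebra_simps)
  qed
  \<comment> \<open>Where the martingale never stops, the densities stay between D - t > 0 and D + t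
    < 1. Hence both A and its complement are null in Z.\<close>
  define Z where "Z = dyadic k i - (\<Union>m. G m)"
  have Z: "Z \<in> sets lebesgue" "bounded Z"
    using lm(1) bounded_subset[OF bounded_dyadic[of k i]] by (auto simp: Z_def)
  have Zd: "\<bar>?d m x - D\<bar> < t" if xZ: "x \<in> Z" and km: "k \<le> m" for x m
  proof (rule ccontr)
    assume "\<not> ?thesis"
    then obtain m' where "x \<in> first_hit p k m'"
      using first_hit_exists[of p m x k, OF _ km] by (auto simp: p_def)
    then show False using xZ by (auto simp: Z_def G_def)
  qed
  have nA: "- A \<in> sets lebesgue"
    using sets.compl_sets[OF A] by (simp add: Compl_eq_Diff_UNIV)
  have "measure lebesgue (A \<inter> Z) = 0"
    using negligible_if_dyadic_density_le[OF A Z, of "D + t" k] Zd t by (force simp: abs_less_iff)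
  moreover have "measure lebesgue (- A \<inter> Z) = 0"
  proof (rule negligible_if_dyadic_density_le[OF _ Z, of "- A" "1 - (D - t)" k])
    fix x m assume "x \<in> Z" "k \<le> m"
    then show "dyadic_density (- A) m (grid_index m x) \<le> 1 - (D - t)"
      using Zd[of x m] A by (simp add: dyadic_density_Compl abs_less_iff)
  qed (use nA t in auto)
  moreover have "Z = (A \<inter> Z) \<union> (- A \<inter> Z)" by blast
  ultimately have Z0: "measure lebesgue Z = 0"
    using measure_Un_le[of "A \<inter> Z" lebesgue "- A \<inter> Z"] A nA Z(1)
    by (metis add.right_neutral measure_le_0_iff sets.Int)
  have "(\<lambda>M. measure lebesgue (dyadic k i - (\<Union>m<M. G m))) \<longlonglongrightarrow> measure lebesgue (\<Inter>M. dyadic k i - (\<Union>m<M. G m))"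
  proof (rule Lim_measure_decseq)
    show "range (\<lambda>M. dyadic k i - (\<Union>m<M. G m)) \<subseteq> sets lebesgue"
      using lm(1) by auto
    show "decseq (\<lambda>M. dyadic k i - (\<Union>m<M. G m))"
      by (force simp: decseq_def)
    show "emeasure lebesgue (dyadic k i - (\<Union>m<M. G m)) \<noteq> \<infinity>" for M
    proof -
      have "dyadic k i - (\<Union>m<M. G m) \<in> lmeasurable"
        using lm(1) by (intro fmeasurable_Diff fmeasurableD[OF fmeasurable.finite_UN]) auto
      then show ?thesis by (metis fmeasurableD2 infinity_ennreal_def)
    qed
  qed
  moreover have "(\<Inter>M. dyadic k i - (\<Union>m<M. G m)) = Z" by (auto simp: Z_def)
  \<comment> \<open>A missing proportion t / 8 costs at most t / 8 in the balance below, because D +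
    t < 1. What remains is 7 t / 8 against 3 t, that is 7 / 24 of the cube, which exceeds 1 /
    4.\<close>
  moreover have "t / 8 * ?v k > 0" using t dyadic_vol_pos[where k = k and 'n = 'n] by simp
  ultimately have "\<forall>\<^sub>F M in sequentially. measure lebesgue (dyadic k i - (\<Union>m<M. G m)) < t / 8 * ?v k"
    using Z0 order_tendstoD(2)[of _ 0 sequentially "t / 8 * ?v k"] by simp
  then obtain M where M: "measure lebesgue (dyadic k i - (\<Union>m<M. G m)) < t / 8 * ?v k"
    using eventually_happens'[OF sequentially_bot] by blast
  define v where "v = (\<Sum>m<M. measure lebesgue (V m))"
  define w where "w = (\<Sum>m<M. measure lebesgue (W m))"
  have GVW: "G m = V m \<union> W m" and VW: "V m \<inter> W m = {}" for m
    using t by (auto simp: V_def W_def G_def first_hit_def p_def)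
  have "measure lebesgue (\<Union>m<M. G m) = (\<Sum>m<M. measure lebesgue (G m))"
    using lm(1) disj by (intro measure_UNION') (auto simp: pairwise_def disjnt_def)
  also have "\<dots> = v + w"
    unfolding v_def w_def sum.distrib[symmetric]
    by (intro sum.cong refl) (simp only: GVW measure_Un_disjoint[OF lm(2) lm(3) VW])
  finally have mG: "measure lebesgue (\<Union>m<M. G m) = v + w" .
  have "measure lebesgue (dyadic k i - (\<Union>m<M. G m)) = ?v k - (v + w)"
    using sub(1) lm(1) mG by (subst measurable_measure_Diff) (auto simp: measure_dyadic)
  with M have vw: "?v k * (1 - t / 8) \<le> v + w" by (simp add: algebra_simps)
  have mV: "(D - t - \<eta>) * measure lebesgue (V m) \<le> measure lebesgue (A \<inter> V m)" for m
  proof (rule measure_Int_saturated_ge[OF satVW(1) bdd(2) A])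
    fix x assume "x \<in> V m"
    then show "D - t - \<eta> \<le> ?d m x" using at[of x m] by (auto simp: V_def abs_le_iff)
  qed
  have mW: "(D + t) * measure lebesgue (W m) \<le> measure lebesgue (A \<inter> W m)" for m
    by (rule measure_Int_saturated_ge[OF satVW(2) bdd(3) A]) (auto simp: W_def)
  have AV: "A \<inter> V m \<in> lmeasurable" "A \<inter> W m \<in> lmeasurable" for m
    by (rule fmeasurable_Int_sets[OF A lm(2)] fmeasurable_Int_sets[OF A lm(3)])+
  \<comment> \<open>Optional stopping as an inequality: A fills the proportion D of the whole cube,
    at least D - t - \<eta> of the downward exits and at least D + t of the upward ones. Too few
    downward exits would give A too much mass.\<close>
  have "(D - t - \<eta>) * v + (D + t) * w \<le> (\<Sum>m<M. measure lebesgue (A \<inter> V m)) + (\<Sum>m<M. measure lebesgue (A \<inter> W m))"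
    unfolding v_def w_def sum_distrib_left using mV mW by (intro add_mono sum_mono)
  also have "\<dots> = (\<Sum>m<M. measure lebesgue (A \<inter> G m))"
    unfolding sum.distrib[symmetric] using AV VW
    by (intro sum.cong refl) (subst measure_Un_disjoint[symmetric], auto simp: GVW Int_Un_distrib)
  also have "\<dots> = measure lebesgue (\<Union>m<M. A \<inter> G m)"
  proof (rule measure_UNION'[symmetric])
    show "pairwise (\<lambda>m j. disjnt (A \<inter> G m) (A \<inter> G j)) {..<M}"
      using disj unfolding pairwise_def disjnt_def by blast
  qed (use fmeasurable_Int_sets[OF A lm(1)] in auto)
  also have "\<dots> \<le> measure lebesgue (A \<inter> dyadic k i)"
    using A lm(1) sub(1) by (intro measure_mono_fmeasurable) auto
  also have "\<dots> = D * ?v k"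
    using dyadic_vol_pos[where 'n='n and k=k] by (simp add: D_def dyadic_density_def)
  finally have "(D - t - \<eta>) * v + (D + t) * w \<le> D * ?v k" .
  moreover have "(D + t) * (?v k * (1 - t / 8) - v) \<le> (D + t) * w"
    using vw t by (intro mult_left_mono) auto
  ultimately have "(D + t) * (?v k * (1 - t / 8)) - D * ?v k \<le> (2 * t + \<eta>) * v"
    by (simp add: algebra_simps)
  moreover have "(D + t) * (?v k * (1 - t / 8)) - D * ?v k = t * ?v k - (D + t) * (?v k * (t / 8))"
    by (simp add: algebra_simps)
  moreover have "(D + t) * (?v k * (t / 8)) \<le> 1 * (?v k * (t / 8))"
    using t dyadic_vol_pos[where 'n='n and k=k] by (intro mult_right_mono) auto
  moreover have "v \<ge> 0" by (simp add: v_def sum_nonneg)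
  moreover have "(2 * t + \<eta>) * v \<le> 3 * t * v"
    using t \<open>v \<ge> 0\<close> by (intro mult_right_mono) auto
  ultimately have "t * (7 / 8 * ?v k) \<le> t * (3 * v)" by (simp add: algebra_simps add_divide_distrib)
  then have "7 / 8 * ?v k \<le> 3 * v" using t by (simp add: mult_le_cancel_left)
  then have v4: "?v k \<le> 4 * v" using \<open>v \<ge> 0\<close> by linarith
  define F where "F = Sigma {..<M} (\<lambda>m. grid_index m ` V m)"
  have dV: "dyadic m j \<subseteq> V m" if "(m, j) \<in> F" for m j
  proof -
    from that have "j \<in> grid_index m ` V m" by (simp add: F_def)
    then show ?thesis using saturated_eq_Union[OF satVW(1)[of m]] by blast
  qed
  show thesis
  proof
    show "finite F" unfolding F_def
      using finite_grid_index_image[OF bdd(2)] by (intro finite_SigmaI) auto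
    show "dyadic (fst q) (snd q) \<inter> dyadic (fst q') (snd q') = {}" if "q \<in> F" "q' \<in> F" "q \<noteq> q'" for q q'
    proof (cases "fst q = fst q'")
      case True
      then show ?thesis using that(3) dyadic_disjoint[of "snd q" "snd q'"] by (auto simp: prod_eq_iff)
    next
      case False
      then show ?thesis
        using dV[of "fst q" "snd q"] dV[of "fst q'" "snd q'"] that disj[OF False] by (fastforce simp: V_def)
    qed
    have "(\<Sum>q\<in>F. ?v (fst q)) = (\<Sum>m<M. \<Sum>j\<in>grid_index m ` V m. ?v m)"
      unfolding F_def using finite_grid_index_image[OF bdd(2)] by (subst sum.Sigma) (auto simp: case_prod_beta)
    also have "\<dots> = v"
      unfolding v_def by (intro sum.cong) (auto simp: measure_saturated[OF satVW(1) bdd(2)])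
    finally show "?v k \<le> 4 * (\<Sum>q\<in>F. ?v (fst q))" using v4 by simp
    fix m j assume mj: "(m, j) \<in> F"
    then obtain x where x: "x \<in> V m" "j = grid_index m x" by (auto simp: F_def)
    have xG: "x \<in> G m" using x by (simp add: V_def)
    have xk: "x \<in> dyadic k i" using x sub by blast
    note km = Gm[OF xG]
    show "k \<le> m \<and> t \<le> real (m - k) * \<eta> \<and> dyadic m j \<subseteq> dyadic k i \<and>
       D - t - \<eta> \<le> dyadic_density A m j \<and> dyadic_density A m j \<le> D - t \<and>
       (\<forall>l. k \<le> l \<and> l \<le> m \<longrightarrow>
         (\<exists>i'. dyadic m j \<subseteq> dyadic l i' \<and> \<bar>dyadic_density A l i' - D\<bar> \<le> t + \<eta>))"
    proof (intro conjI allI impI)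
      show "k \<le> m" using km by simp
      show "dyadic m j \<subseteq> dyadic k i" using dV[OF mj] sub by blast
      show "D - t - \<eta> \<le> dyadic_density A m j" using at[OF xG] x by (auto simp: abs_le_iff)
      show up: "dyadic_density A m j \<le> D - t" using x by (simp add: V_def)
      show "t \<le> real (m - k) * \<eta>"
        using steps[OF xk, of "m - k"] km up x by auto
      fix l assume l: "k \<le> l \<and> l \<le> m"
      have "dyadic m j \<subseteq> dyadic l (grid_index l x)"
        using l x by (intro dyadic_nested) auto
      moreover have "\<bar>?d l x - D\<bar> \<le> t + \<eta>"
        using before[OF xG, of l] at[OF xG] l t by (cases "l = m") auto
      ultimately show "\<exists>i'. dyadic m j \<subseteq> dyadic l i' \<and> \<bar>dyadic_density A l i' - D\<bar> \<le> t + \<eta>"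
        by blast
    qed
  qed
qed

subsection \<open>Trees of dyadic cubes and countable covers\<close>

text \<open>Either the interval of length l stays in the window of radius 2 d about u, and the
  overlap is l, or it runs from p to an end of the window, which is at distance at least d from
  p.\<close>

lemma min_le_overlap:
  fixes a b p u d l :: real
  assumes "\<bar>p - u\<bar> \<le> d" "a \<le> p" "p \<le> b" "b = a + l" "0 < d" "0 < l"
  shows "min l d \<le> min b (u + 2 * d) - max a (u - 2 * d)"
  using assms by (auto simp: min_def max_def abs_le_iff)

lemma reciprocals_cancel_le:
  fixes a a' b b' c :: real
  assumes "a * (a' * b') \<le> b * c * (a' * b')" "a * a' = 1" "b * b' = 1"
  shows "b' \<le> c * a'"
proof -
  have "a * (a' * b') = a * a' * b'" "b * c * (a' * b') = b * b' * (c * a')" by simp_all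
  then show ?thesis using assms by (simp only: mult_1)
qed

lemma dyadic_box_Int_cbox_measure_ge:
  fixes i :: "int ^ 'n" and u :: "real ^ 'n"
  assumes d: "d > 0" and p: "p \<in> dyadic_box k i" "dist p u \<le> d"
  shows "min (1 / 2 ^ k) d ^ CARD('n) \<le> measure lebesgue (dyadic_box k i \<inter> cbox (u - vec (2 * d)) (u + vec (2 * d)))"
proof -
  let ?a = "\<lambda>j. of_int (i $ j) / 2 ^ k :: real" and ?b = "\<lambda>j. (of_int (i $ j) + 1) / 2 ^ k :: real"
  let ?a' = "\<chi> j. max (?a j) (u $ j - 2 * d)" and ?b' = "\<chi> j. min (?b j) (u $ j + 2 * d)"
  have eq: "dyadic_box k i \<inter> cbox (u - vec (2 * d)) (u + vec (2 * d)) = cbox ?a' ?b'"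
    unfolding dyadic_box_def by (auto simp: set_eq_iff mem_box_cart)
  have ge: "min (1 / 2 ^ k) d \<le> ?b' $ j - ?a' $ j" for j
  proof -
    have "\<bar>p $ j - u $ j\<bar> \<le> d"
      using p(2) component_le_norm_cart[of "p - u" j] by (simp add: dist_norm)
    moreover have "?a j \<le> p $ j" "p $ j \<le> ?b j"
      using p(1) by (auto simp: dyadic_box_def mem_box_cart)
    moreover have "?b j = ?a j + 1 / 2 ^ k" by (simp add: add_divide_distrib)
    ultimately show ?thesis using d min_le_overlap[of "p $ j" "u $ j" d "?a j" "?b j" "1 / 2 ^ k"] by simp
  qed
  have pos: "0 < min (1 / 2 ^ k) d" using d by simp
  have "min (1 / 2 ^ k) d ^ CARD('n) = (\<Prod>j\<in>(UNIV :: 'n set). min (1 / 2 ^ k) d)" by simp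
  also have "\<dots> \<le> (\<Prod>j\<in>UNIV. ?b' $ j - ?a' $ j)"
    using ge pos by (intro prod_mono conjI) (auto intro: less_imp_le)
  also have "\<dots> = measure lebesgue (cbox ?a' ?b')"
    using ge pos by (intro measure_lebesgue_cbox_cart[symmetric]) (smt (verit))
  finally show ?thesis using eq by simp
qed

text \<open>Packing in the box of side 4 d about a point of V: every cube meeting V has at least
  volume min(l, d)^n inside that box, and the cubes are disjoint. Truncation at d lets cubes of all
  sizes be treated at once.\<close>

lemma sum_min_dyadic_le:
  fixes F :: "(nat \<times> (int ^ 'n)) set" and V :: "(real ^ 'n) set"
  assumes F: "finite F" "\<And>q q'. q \<in> F \<Longrightarrow> q' \<in> F \<Longrightarrow> q \<noteq> q' \<Longrightarrow> dyadic (fst q) (snd q) \<inter> dyadic (fst q') (snd q') = {}"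
    and d: "d > 0" "\<And>x y. x \<in> V \<Longrightarrow> y \<in> V \<Longrightarrow> dist x y \<le> d"
    and meet: "\<And>q. q \<in> F \<Longrightarrow> V \<inter> dyadic_box (fst q) (snd q) \<noteq> {}"
  shows "(\<Sum>q\<in>F. min (1 / 2 ^ fst q) d ^ CARD('n)) \<le> (4 * d) ^ CARD('n)"
proof (cases "F = {}")
  case False
  then obtain u where u: "u \<in> V" using meet by blast
  let ?B = "cbox (u - vec (2 * d)) (u + vec (2 * d))"
  have "min (1 / 2 ^ fst q) d ^ CARD('n) \<le> measure lebesgue (?B \<inter> dyadic (fst q) (snd q))" if q: "q \<in> F" for q
  proof -
    obtain p where p: "p \<in> V" "p \<in> dyadic_box (fst q) (snd q)" using meet[OF q] by blast
    show ?thesis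
      using dyadic_box_Int_cbox_measure_ge[OF d(1) p(2) d(2)[OF p(1) u]]
        measure_Int_dyadic_box[of ?B "fst q" "snd q"] by (simp add: Int_commute)
  qed
  then have "(\<Sum>q\<in>F. min (1 / 2 ^ fst q) d ^ CARD('n)) \<le> (\<Sum>q\<in>F. measure lebesgue (?B \<inter> dyadic (fst q) (snd q)))"
    by (intro sum_mono)
  also have "\<dots> = measure lebesgue (\<Union>q\<in>F. ?B \<inter> dyadic (fst q) (snd q))"
  proof (rule measure_UNION'[symmetric])
    show "pairwise (\<lambda>q q'. disjnt (?B \<inter> dyadic (fst q) (snd q)) (?B \<inter> dyadic (fst q') (snd q'))) F"
      unfolding pairwise_def disjnt_def using F(2) by blast
  qed (use F(1) in auto)
  also have "\<dots> \<le> measure lebesgue ?B"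
    using F(1) by (intro measure_mono_fmeasurable sets.finite_UN sets.Int) auto
  also have "\<dots> = (4 * d) ^ CARD('n)"
    using d(1) by (subst measure_lebesgue_cbox_cart) auto
  finally show ?thesis .
qed (use d in simp)

text \<open>
  The invariant \<open>\<Phi> q < c l(q)\<^sup>s\<close> on the part of the cover meeting \<open>q\<close> is inherited by
  some child: weighting the cover by \<open>min(l(q'), d\<^sub>i)\<^sup>n d\<^sub>i\<^sup>s\<^sup>-\<^sup>n\<close> makes the sum
  over disjoint children at most \<open>4\<^sup>n \<Phi> q\<close>, whereas each child violating the invariant contributes
  at least \<open>l(q')\<^sup>n l(q)\<^sup>s\<^sup>-\<^sup>n\<close>, and the children fill a quarter of \<open>q\<close>. Only the mass of the
  children and their relative smallness enter, not their number.
\<close>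

lemma dyadic_family_avoiding_cover:
  fixes F :: "(nat \<times> (int ^ 'n)) set" and U :: "nat \<Rightarrow> (real ^ 'n) set" and d :: "nat \<Rightarrow> real" and s :: real
  defines "n \<equiv> CARD('n)"
  defines "meets \<equiv> \<lambda>q i. U i \<inter> dyadic_box (fst q) (snd q) \<noteq> {}"
  defines "\<Phi> \<equiv> \<lambda>q. \<Sum>i. if meets q i then d i powr s else 0"
  assumes s: "0 < s" "s < real n"
    and N: "(1 / 2 ^ N) powr (real n - s) \<le> (1 / 4) ^ Suc n"
    and d: "\<And>i. d i > 0" "\<And>i x y. x \<in> U i \<Longrightarrow> y \<in> U i \<Longrightarrow> dist x y \<le> d i" "summable (\<lambda>i. d i powr s)"
    and F: "finite F" "\<And>q q'. q \<in> F \<Longrightarrow> q' \<in> F \<Longrightarrow> q \<noteq> q' \<Longrightarrow> dyadic (fst q) (snd q) \<inter> dyadic (fst q') (snd q') = {}"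
    "\<And>q'. q' \<in> F \<Longrightarrow> fst q + N \<le> fst q' \<and> dyadic (fst q') (snd q') \<subseteq> dyadic (fst q) (snd q)"
    "dyadic_vol TYPE('n) (fst q) \<le> 4 * (\<Sum>q'\<in>F. dyadic_vol TYPE('n) (fst q'))"
    and \<Phi>: "\<Phi> q < (1 / 4) ^ Suc n * (1 / 2 ^ fst q) powr s"
  shows "\<And>i. meets q i \<Longrightarrow> d i < 1 / 2 ^ fst q"
    and "\<exists>q'\<in>F. \<Phi> q' < (1 / 4) ^ Suc n * (1 / 2 ^ fst q') powr s"
proof -
  define l where "l q = (1 / 2 ^ fst q :: real)" for q :: "nat \<times> (int ^ 'n)"
  \<comment> \<open>One factor 4^n is lost in the packing estimate and one factor 4 because the
    children fill only a quarter of q; this c makes the two bounds below meet exactly.\<close>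
  define c where "c = (1 / 4 :: real) ^ Suc n"
  have l: "l q > 0" for q by (simp add: l_def)
  have c: "0 < c" "4 ^ n * c = 1 / 4" by (simp_all add: c_def power_one_over)
  have c1: "c \<le> 1" unfolding c_def by (rule power_le_one) auto
  have summ: "summable (\<lambda>i. if meets q i then d i powr s else 0)" for q
    by (rule summable_comparison_test[OF _ d(3)]) auto
  \<comment> \<open>A set of the cover as large as q would by itself exceed the bound on \<Phi>
    q.\<close>
  show small: "d i < 1 / 2 ^ fst q" if "meets q i" for i
  proof -
    have "d i powr s = (\<Sum>j\<in>{i}. if meets q j then d j powr s else 0)" using that by simp
    also have "\<dots> \<le> \<Phi> q" unfolding \<Phi>_def by (rule sum_le_suminf[OF summ]) auto
    also have "\<dots> < c * l q powr s" using \<Phi> by (simp add: c_def l_def)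
    also have "\<dots> \<le> l q powr s" using c c1 by (intro mult_left_le_one_le) auto
    finally have "d i powr s < l q powr s" .
    then show ?thesis
      using powr_mono2[of s "l q" "d i"] s l[of q] by (force simp: l_def)
  qed
  show "\<exists>q'\<in>F. \<Phi> q' < (1 / 4) ^ Suc n * (1 / 2 ^ fst q') powr s"
  proof (rule ccontr)
    assume "\<not> ?thesis"
    then have big: "c * l q' powr s \<le> \<Phi> q'" if "q' \<in> F" for q'
      using that by (force simp: c_def l_def)
    define g where "g q' i = (if meets q' i then min (l q') (d i) ^ n * d i powr (s - n) else 0)" for q' i
    have dsplit: "d i powr s = d i ^ n * d i powr (s - n)" for i
      using d(1)[of i] by (simp add: powr_realpow[symmetric] powr_add[symmetric])
    have g0: "0 \<le> g q' i" for q' i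
      using l[of q'] d(1)[of i] by (simp add: g_def)
    have gle: "g q' i \<le> d i powr s" for q' i
      using l[of q'] d(1)[of i] by (auto simp: g_def dsplit intro!: mult_right_mono power_mono)
    have gsum: "summable (g q')" for q'
      by (rule summable_comparison_test[OF _ d(3)]) (use g0 gle in auto)
    have lower: "l q' ^ n * l q powr (s - n) \<le> suminf (g q')" if q': "q' \<in> F" for q'
    proof (cases "\<exists>i. meets q' i \<and> l q' \<le> d i")
      \<comment> \<open>One large set suffices: its weight is l(q')^n d^(s-n), and d is below l(q)
        while the exponent s - n is negative.\<close>
      case True
      then obtain i where i: "meets q' i" "l q' \<le> d i" by blast
      have "meets q i"
        using i(1) dyadic_box_mono[of "fst q'" "snd q'" "fst q" "snd q"] F(3)[OF q'] by (auto simp: meets_def)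
      then have "d i \<le> l q" using small[of i] by (simp add: l_def)
      then have "l q powr (s - n) \<le> d i powr (s - n)"
        using d(1)[of i] s by (intro powr_mono2') auto
      then have "l q' ^ n * l q powr (s - n) \<le> g q' i"
        using i l[of q'] by (auto simp: g_def intro: mult_left_mono)
      also have "\<dots> = (\<Sum>j\<in>{i}. g q' j)" by simp
      also have "\<dots> \<le> suminf (g q')" by (rule sum_le_suminf[OF gsum]) (use g0 in auto)
      finally show ?thesis .
    next
      \<comment> \<open>All sets meeting q' are smaller than q', so the truncation is inactive and
        the weights add up to \<Phi> q'. That q' is 2^N times smaller than q pays for the factor
        c.\<close>
      case False
      then have "g q' i = (if meets q' i then d i powr s else 0)" for i
        by (auto simp: g_def dsplit min_def)
      then have eq: "suminf (g q') = \<Phi> q'" unfolding \<Phi>_def by (intro suminf_cong)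
      have "l q' \<le> l q * (1 / 2 ^ N)"
        using F(3)[OF q'] power_increasing[of "fst q + N" "fst q'" "2 :: real"] by (simp add: l_def power_add field_simps)
      then have "l q' powr (n - s) \<le> (l q * (1 / 2 ^ N)) powr (n - s)"
        using l[of q'] s by (intro powr_mono2) auto
      also have "\<dots> \<le> l q powr (n - s) * c"
        unfolding powr_mult c_def using N by (intro mult_left_mono) auto
      finally have "l q' powr (n - s) * (l q' powr (s - n) * l q powr (s - n)) \<le> l q powr (n - s) * c * (l q' powr (s - n) * l q powr (s - n))"
        by (intro mult_right_mono) auto
      moreover have "l q' powr (n - s) * l q' powr (s - n) = 1" "l q powr (n - s) * l q powr (s - n) = 1"
        using l[of q] l[of q'] by (simp_all add: powr_add[symmetric])
      ultimately have "l q powr (s - n) \<le> c * l q' powr (s - n)"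
        by (rule reciprocals_cancel_le)
      then have "l q' ^ n * l q powr (s - n) \<le> l q' ^ n * (c * l q' powr (s - n))"
        using l[of q'] by (intro mult_left_mono) auto
      also have "\<dots> = c * l q' powr s"
        using l[of q'] by (simp add: powr_realpow[symmetric] powr_add[symmetric])
      finally show ?thesis using big[OF q'] eq by simp
    qed
    have upper: "(\<Sum>q'\<in>F. g q' i) \<le> 4 ^ n * (if meets q i then d i powr s else 0)" for i
    proof -
      let ?F = "{q' \<in> F. meets q' i}"
      have "(\<Sum>q'\<in>F. g q' i) = (\<Sum>q'\<in>?F. min (l q') (d i) ^ n) * d i powr (s - n)"
        using F(1) by (simp add: g_def sum.If_cases Int_def sum_distrib_right)
      also have "\<dots> \<le> 4 ^ n * (if meets q i then d i powr s else 0)"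
      proof (cases "meets q i")
        case True
        have "(\<Sum>q'\<in>?F. min (l q') (d i) ^ n) \<le> (4 * d i) ^ n"
          unfolding n_def l_def using F(1,2) d(1,2) by (intro sum_min_dyadic_le[of _ _ "U i"]) (auto simp: meets_def)
        then have "(\<Sum>q'\<in>?F. min (l q') (d i) ^ n) * d i powr (s - n) \<le> (4 * d i) ^ n * d i powr (s - n)"
          by (intro mult_right_mono) auto
        then show ?thesis using True by (simp add: dsplit power_mult_distrib)
      next
        case False
        then have "\<not> meets q' i" if "q' \<in> F" for q'
          using dyadic_box_mono[of "fst q'" "snd q'" "fst q" "snd q"] F(3)[OF that] by (auto simp: meets_def)
        then have "?F = {}" by blast
        then show ?thesis using False by (simp only: sum.empty) simp
      qed
      finally show ?thesis .
    qed
    have "l q ^ n / 4 * l q powr (s - n) \<le> (\<Sum>q'\<in>F. l q' ^ n) * l q powr (s - n)"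
      using F(4) by (intro mult_right_mono) (auto simp: dyadic_vol_def l_def n_def)
    also have "\<dots> \<le> (\<Sum>q'\<in>F. suminf (g q'))"
      unfolding sum_distrib_right using lower by (intro sum_mono)
    also have "\<dots> = (\<Sum>i. \<Sum>q'\<in>F. g q' i)"
      using gsum by (intro suminf_sum[symmetric])
    also have "\<dots> \<le> (\<Sum>i. 4 ^ n * (if meets q i then d i powr s else 0))"
      using upper gsum summ by (intro suminf_le summable_sum summable_mult)
    also have "\<dots> = 4 ^ n * \<Phi> q"
      unfolding \<Phi>_def by (rule suminf_mult[OF summ])
    also have "\<dots> < 4 ^ n * (c * l q powr s)"
      using \<Phi> by (simp add: c_def l_def)
    also have "\<dots> = l q powr s / 4" using c(2) by (simp add: mult.assoc[symmetric])
    also have "\<dots> = l q ^ n / 4 * l q powr (s - n)"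
      using l[of q] by (simp add: powr_realpow[symmetric] powr_add[symmetric])
    finally show False by simp
  qed
qed

text \<open>The branch is chosen in response to the cover. \<open>P\<close> keeps the construction
  going, and \<open>R\<close> records along the branch whatever the application wants to know about
  the limit point.\<close>

lemma dyadic_tree_point_outside_cover:
  fixes q0 :: "nat \<times> (int ^ 'n)" and U :: "nat \<Rightarrow> (real ^ 'n) set" and d :: "nat \<Rightarrow> real"
  assumes s: "0 < s" "s < real CARD('n)"
    and N: "(1 / 2 ^ N) powr (real CARD('n) - s) \<le> (1 / 4) ^ Suc CARD('n)"
    and d: "\<And>i. d i > 0" "\<And>i x y. x \<in> U i \<Longrightarrow> y \<in> U i \<Longrightarrow> dist x y \<le> d i" "summable (\<lambda>i. d i powr s)"
    and small: "(\<Sum>i. d i powr s) < (1 / 4) ^ Suc CARD('n) * (1 / 2 ^ fst q0) powr s"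
    and q0: "P q0"
    and step: "\<And>q. P q \<Longrightarrow> \<exists>F. finite F \<and>
       (\<forall>q'\<in>F. \<forall>q''\<in>F. q' \<noteq> q'' \<longrightarrow> dyadic (fst q') (snd q') \<inter> dyadic (fst q'') (snd q'') = {}) \<and>
       (\<forall>q'\<in>F. P q' \<and> R q q' \<and> fst q + N \<le> fst q' \<and> dyadic (fst q') (snd q') \<subseteq> dyadic (fst q) (snd q)) \<and>
       dyadic_vol TYPE('n) (fst q) \<le> 4 * (\<Sum>q'\<in>F. dyadic_vol TYPE('n) (fst q'))"
  obtains q y where "q 0 = q0" "\<And>k. P (q k)" "\<And>k. R (q k) (q (Suc k))" "\<And>k. fst (q k) < fst (q (Suc k))"
    "\<And>k. y \<in> dyadic_box (fst (q k)) (snd (q k))" "\<And>i. y \<notin> U i"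
proof -
  define meets where "meets q i \<longleftrightarrow> U i \<inter> dyadic_box (fst q) (snd q) \<noteq> {}" for q :: "nat \<times> (int ^ 'n)" and i
  define \<Phi> where "\<Phi> q = (\<Sum>i. if meets q i then d i powr s else 0)" for q
  let ?c = "(1 / 4 :: real) ^ Suc CARD('n)"
  define Inv where "Inv q \<longleftrightarrow> P q \<and> \<Phi> q < ?c * (1 / 2 ^ fst q) powr s" for q
  let ?box = "\<lambda>q :: nat \<times> (int ^ 'n). dyadic_box (fst q) (snd q)"
  have N0: "N > 0"
  proof (rule ccontr)
    assume "\<not> N > 0"
    then have "(1::real) \<le> (1 / 4) ^ Suc CARD('n)" using N by simp
    moreover have "(1 / 4 :: real) ^ Suc CARD('n) < 1" by (rule power_Suc_less_one) auto
    ultimately show False by simp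
  qed
  have descend: "(\<forall>i. meets q i \<longrightarrow> d i < 1 / 2 ^ fst q) \<and>
    (\<exists>q'. Inv q' \<and> R q q' \<and> fst q < fst q' \<and> ?box q' \<subseteq> ?box q)" if "Inv q" for q
  proof -
    have "P q" and \<Phi>q: "\<Phi> q < ?c * (1 / 2 ^ fst q) powr s" using that by (auto simp: Inv_def)
    from step[OF \<open>P q\<close>] obtain F where F: "finite F"
      "\<forall>q'\<in>F. \<forall>q''\<in>F. q' \<noteq> q'' \<longrightarrow> dyadic (fst q') (snd q') \<inter> dyadic (fst q'') (snd q'') = {}"
      "\<forall>q'\<in>F. P q' \<and> R q q' \<and> fst q + N \<le> fst q' \<and> dyadic (fst q') (snd q') \<subseteq> dyadic (fst q) (snd q)"
      "dyadic_vol TYPE('n) (fst q) \<le> 4 * (\<Sum>q'\<in>F. dyadic_vol TYPE('n) (fst q'))"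
      by (elim exE conjE) (rule that)
    have F3: "fst q + N \<le> fst q' \<and> dyadic (fst q') (snd q') \<subseteq> dyadic (fst q) (snd q)" if "q' \<in> F" for q'
      using F(3) that by simp
    note * = dyadic_family_avoiding_cover[OF s N d F(1) F(2)[rule_format] F3 F(4) \<Phi>q[unfolded \<Phi>_def meets_def]]
    from *(2) obtain q' where q': "q' \<in> F" "\<Phi> q' < ?c * (1 / 2 ^ fst q') powr s"
      unfolding \<Phi>_def meets_def by blast
    have "?box q' \<subseteq> ?box q" using F3[OF q'(1)] by (intro dyadic_box_mono) simp
    then have "Inv q' \<and> R q q' \<and> fst q < fst q' \<and> ?box q' \<subseteq> ?box q"
      using q' F(3) F3[OF q'(1)] N0 by (auto simp: Inv_def)
    moreover have "\<forall>i. meets q i \<longrightarrow> d i < 1 / 2 ^ fst q" using *(1) unfolding meets_def by simp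
    ultimately show ?thesis by blast
  qed
  have "\<Phi> q0 \<le> (\<Sum>i. d i powr s)"
    unfolding \<Phi>_def by (rule suminf_le[OF _ _ d(3)]) (auto intro: summable_comparison_test[OF _ d(3)])
  then have Inv0: "Inv q0" using small q0 by (simp add: Inv_def)
  have "\<exists>q. \<forall>k. (Inv (q k) \<and> (k = 0 \<longrightarrow> q k = q0)) \<and>
      (R (q k) (q (Suc k)) \<and> fst (q k) < fst (q (Suc k)) \<and> ?box (q (Suc k)) \<subseteq> ?box (q k))"
  proof (rule dependent_nat_choice)
    show "\<exists>q. Inv q \<and> (0 = (0::nat) \<longrightarrow> q = q0)" using Inv0 by blast
    fix q and k :: nat assume "Inv q \<and> (k = 0 \<longrightarrow> q = q0)"
    then have "\<exists>q'. Inv q' \<and> R q q' \<and> fst q < fst q' \<and> ?box q' \<subseteq> ?box q" using descend[of q] by simp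
    then show "\<exists>q'. (Inv q' \<and> (Suc k = 0 \<longrightarrow> q' = q0)) \<and> R q q' \<and> fst q < fst q' \<and> ?box q' \<subseteq> ?box q" by simp
  qed
  then obtain q where "\<forall>k. (Inv (q k) \<and> (k = 0 \<longrightarrow> q k = q0)) \<and>
      (R (q k) (q (Suc k)) \<and> fst (q k) < fst (q (Suc k)) \<and> ?box (q (Suc k)) \<subseteq> ?box (q k))"
    by (rule exE)
  then have q: "Inv (q k)" "q 0 = q0"
    "R (q k) (q (Suc k)) \<and> fst (q k) < fst (q (Suc k)) \<and> ?box (q (Suc k)) \<subseteq> ?box (q k)" for k
    by simp_all
  have dec: "decseq (\<lambda>k. ?box (q k))"
    by (rule decseq_SucI) (use q(3) in simp)
  have "\<Inter>(range (\<lambda>k. ?box (q k))) \<noteq> {}"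
  proof (rule compact_nest)
    show "compact (?box (q k))" for k by (simp add: dyadic_box_def)
    show "?box (q k) \<noteq> {}" for k
      using dyadic_nonempty[of "fst (q k)" "snd (q k)"] dyadic_subset_box[of "fst (q k)" "snd (q k)"] by blast
    show "?box (q m) \<subseteq> ?box (q k)" if "k \<le> m" for k m
      using decseqD[OF dec that] .
  qed
  then obtain y where y: "\<And>k. y \<in> ?box (q k)" by blast
  have "y \<notin> U i" for i
  proof
    assume "y \<in> U i"
    \<comment> \<open>Every cube of the branch contains y, hence meets U i; this bounds the positive
      number d i by side lengths tending to 0.\<close>
    have "strict_mono (\<lambda>k. fst (q k))" using q(3) by (simp add: strict_mono_Suc_iff)
    then have "k \<le> fst (q k)" for k using strict_mono_imp_increasing by blast
    moreover obtain k where "1 / 2 ^ k < d i"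
      using eventually_happens'[OF sequentially_bot eventually_divide_power2_less[OF d(1)[of i], of 1]] by blast
    moreover have "d i < 1 / 2 ^ fst (q k)"
      using descend[OF q(1)[of k]] y[of k] \<open>y \<in> U i\<close> by (auto simp: meets_def)
    ultimately show False
      using power_increasing[of k "fst (q k)" "2 :: real"] by (smt (verit) frac_le zero_less_power)
  qed
  then show thesis using that[of q y] q y by (auto simp: Inv_def)
qed

subsection \<open>Hausdorff measure\<close>

lemma hausdorff_content_le:
  assumes "E \<subseteq> (\<Union>i. U i)" "\<And>i. bounded (U i)" "\<And>i. diameter (U i) \<le> \<delta>"
  shows "hausdorff_content s \<delta> E \<le> (\<Sum>i. diameter_powr s (U i))"
  unfolding hausdorff_content_def using assms by (intro Inf_lower) blast

lemma hausdorff_content_lessD: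
  assumes "hausdorff_content s \<delta> E < b"
  obtains U where "E \<subseteq> (\<Union>i. U i)" "\<And>i. bounded (U i)" "\<And>i. diameter (U i) \<le> \<delta>"
    "(\<Sum>i. diameter_powr s (U i)) < b"
  using assms unfolding hausdorff_content_def Inf_less_iff by blast

lemma hausdorff_content_mono: "E \<subseteq> E' \<Longrightarrow> hausdorff_content s \<delta> E \<le> hausdorff_content s \<delta> E'"
  unfolding hausdorff_content_def by (intro Inf_superset_mono) blast

lemma hausdorff_content_UN_null:
  fixes E :: "nat \<Rightarrow> 'a::metric_space set"
  assumes "\<And>m. hausdorff_content s \<delta> (E m) = 0"
  shows "hausdorff_content s \<delta> (\<Union>m. E m) = 0"
proof -
  have "hausdorff_content s \<delta> (\<Union>m. E m) \<le> 0 + ennreal e" if "e > 0" for e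
  proof -
    have "\<exists>U. E m \<subseteq> (\<Union>i. U i) \<and> (\<forall>i. bounded (U i) \<and> diameter (U i) \<le> \<delta>) \<and>
        (\<Sum>i. diameter_powr s (U i)) < ennreal (e * (1 / 2) ^ Suc m)" for m
    proof -
      have "hausdorff_content s \<delta> (E m) < ennreal (e * (1 / 2) ^ Suc m)"
        using assms that by simp
      then show ?thesis by (elim hausdorff_content_lessD) blast
    qed
    then obtain U where U: "\<And>m. E m \<subseteq> (\<Union>i. U m i)" "\<And>m i. bounded (U m i) \<and> diameter (U m i) \<le> \<delta>"
      "\<And>m. (\<Sum>i. diameter_powr s (U m i)) < ennreal (e * (1 / 2) ^ Suc m)"
      by metis
    let ?V = "\<lambda>k. case prod_decode k of (m, i) \<Rightarrow> U m i"
    have "hausdorff_content s \<delta> (\<Union>m. E m) \<le> (\<Sum>k. diameter_powr s (?V k))"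
    proof (rule hausdorff_content_le)
      show "(\<Union>m. E m) \<subseteq> (\<Union>k. ?V k)"
      proof
        fix x assume "x \<in> (\<Union>m. E m)"
        then obtain m i where "x \<in> U m i" using U(1) by blast
        then have "x \<in> ?V (prod_encode (m, i))" by simp
        then show "x \<in> (\<Union>k. ?V k)" by (rule UN_I[OF UNIV_I])
      qed
    qed (use U(2) in \<open>auto split: prod.split\<close>)
    also have "\<dots> = (\<Sum>k. (\<lambda>(m, i). diameter_powr s (U m i)) (prod_decode k))"
      by (simp add: case_prod_beta)
    also have "\<dots> = (\<Sum>m. \<Sum>i. diameter_powr s (U m i))"
      by (rule suminf_ennreal_2dimen) simp
    also have "\<dots> \<le> (\<Sum>m. ennreal (e * (1 / 2) ^ Suc m))"
      using U(3) by (intro suminf_le) (auto intro: less_imp_le)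
    also have "\<dots> = ennreal (\<Sum>m. e * (1 / 2) ^ Suc m)"
      using that sums_mult[OF power_half_series, of e] by (intro suminf_ennreal2) (auto simp: sums_iff)
    also have "(\<Sum>m. e * (1 / 2) ^ Suc m) = e"
      using sums_mult[OF power_half_series, of e] by (simp add: sums_iff)
    finally show ?thesis by simp
  qed
  then have "hausdorff_content s \<delta> (\<Union>m. E m) \<le> 0"
    by (rule ennreal_le_epsilon)
  then show ?thesis by simp
qed

text \<open>The 2^(k n) subcubes of generation k have diameter at most n / 2^k, so their s-sum is at
  most n^s 2^(k (n - s)), which tends to 0 for s > n.\<close>

lemma hausdorff_content_dyadic_null:
  fixes i :: "int ^ 'n"
  assumes s: "s > real CARD('n)" and \<delta>: "\<delta> > 0"
  shows "hausdorff_content s \<delta> (dyadic 0 i) = 0"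
proof -
  let ?n = "real CARD('n)"
  let ?b = "\<lambda>k. ?n powr s * (2 powr (?n - s)) ^ k"
  have ev: "\<forall>\<^sub>F k in sequentially. hausdorff_content s \<delta> (dyadic 0 i) \<le> ennreal (?b k)"
    using eventually_divide_power2_less[OF \<delta>, of ?n]
  proof eventually_elim
    case (elim k)
    let ?I = "grid_index k ` dyadic 0 i"
    define N where "N = card ?I"
    have fin: "finite ?I" by (rule finite_grid_index_image[OF bounded_dyadic])
    obtain e where e: "bij_betw e {..<N} ?I"
      using ex_bij_betw_nat_finite[OF fin] by (auto simp: N_def atLeast0LessThan)
    define U where "U j = (if j < N then dyadic k (e j) else {})" for j
    have diam: "diameter (U j) \<le> ?n / 2 ^ k" for j
    proof (rule diameter_le)
      show "norm (x - y) \<le> ?n / 2 ^ k" if "x \<in> U j" "y \<in> U j" for x y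
      proof -
        have "x \<in> dyadic k (e j)" "y \<in> dyadic k (e j)" using that by (auto simp: U_def split: if_splits)
        then show ?thesis using dist_dyadic_le[of k x y] by (simp add: dyadic_def dist_norm)
      qed
    qed simp
    have "real N * dyadic_vol TYPE('n) k = dyadic_vol TYPE('n) 0"
      using measure_saturated[OF saturated_dyadic[of 0 k i] bounded_dyadic] by (simp add: measure_dyadic N_def)
    then have N: "real N = (2 ^ k) ^ CARD('n)"
      by (simp add: dyadic_vol_def field_simps)
    have "hausdorff_content s \<delta> (dyadic 0 i) \<le> (\<Sum>j. diameter_powr s (U j))"
    proof (rule hausdorff_content_le)
      show "dyadic 0 i \<subseteq> (\<Union>j. U j)"
      proof
        fix x assume "x \<in> dyadic 0 i"
        then obtain j where "j < N" "e j = grid_index k x"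
          using imageI[of x "dyadic 0 i" "grid_index k"] unfolding bij_betw_imp_surj_on[OF e, symmetric] by auto
        then have "x \<in> U j" by (simp add: U_def)
        then show "x \<in> (\<Union>j. U j)" by blast
      qed
      show "bounded (U j)" for j by (simp add: U_def bounded_dyadic)
      show "diameter (U j) \<le> \<delta>" for j using diam[of j] elim by simp
    qed
    also have "\<dots> = (\<Sum>j<N. diameter_powr s (U j))"
      by (rule suminf_finite) (auto simp: U_def diameter_powr_def)
    also have "\<dots> \<le> (\<Sum>j<N. ennreal ((?n / 2 ^ k) powr s))"
    proof (rule sum_mono)
      fix j
      show "diameter_powr s (U j) \<le> ennreal ((?n / 2 ^ k) powr s)"
        using diam[of j] s by (auto simp: diameter_powr_def U_def diameter_ge_0 bounded_dyadic intro!: ennreal_leI powr_mono2)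
    qed
    also have "\<dots> = ennreal (real N * (?n / 2 ^ k) powr s)"
      by (simp add: ennreal_mult ennreal_of_nat_eq_real_of_nat)
    also have "real N * (?n / 2 ^ k) powr s = ?b k"
    proof -
      have "real N = 2 powr (real k * ?n)" by (simp add: N powr_realpow[symmetric] powr_powr)
      moreover have "(?n / 2 ^ k) powr s = ?n powr s * 2 powr (- (real k * s))"
        by (simp add: powr_divide powr_realpow[symmetric] powr_powr powr_minus_divide)
      moreover have "(2 powr (?n - s)) ^ k = 2 powr (real k * ?n) * 2 powr (- (real k * s))"
        by (simp add: powr_realpow[symmetric] powr_powr powr_add[symmetric] algebra_simps)
      ultimately show ?thesis by simp
    qed
    finally show ?case .
  qed
  have "2 powr (?n - s) < 1" using s powr_less_mono[of "?n - s" 0 2] by simp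
  then have "(\<lambda>k. (2 powr (?n - s)) ^ k) \<longlonglongrightarrow> 0"
    by (intro LIMSEQ_realpow_zero) simp_all
  then have "?b \<longlonglongrightarrow> ?n powr s * 0" by (rule tendsto_mult_left)
  then have "(\<lambda>k. ennreal (?b k)) \<longlonglongrightarrow> ennreal 0" by (intro tendsto_ennrealI) simp
  then have "hausdorff_content s \<delta> (dyadic 0 i) \<le> ennreal 0"
    using ev by (intro tendsto_lowerbound) auto
  then show ?thesis by simp
qed

lemma hausdorff_dim_le_CARD: "hausdorff_dim E \<le> of_nat CARD('n)" for E :: "(real ^ 'n) set"
proof (rule ennreal_le_epsilon)
  fix e :: real assume e: "e > 0"
  let ?s = "real CARD('n) + e"
  have "hausdorff_content ?s \<delta> E = 0" if "\<delta> > 0" for \<delta>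
  proof -
    have "E \<subseteq> (\<Union>m. dyadic 0 (from_nat m))"
      by (auto simp: dyadic_def) (metis from_nat_to_nat)
    from hausdorff_content_mono[OF this, of ?s \<delta>] show ?thesis
      using hausdorff_content_UN_null[of ?s \<delta> "\<lambda>m. dyadic 0 (from_nat m :: int ^ 'n)"]
        hausdorff_content_dyadic_null[where 'n = 'n and s = ?s and \<delta> = \<delta>] e that by simp
  qed
  then have "hausdorff_measure ?s E = 0" by (simp add: hausdorff_measure_def)
  then have "hausdorff_dim E \<le> ennreal ?s"
    unfolding hausdorff_dim_def using e by (intro Inf_lower CollectI exI[of _ ?s]) simp
  then show "hausdorff_dim E \<le> of_nat CARD('n) + ennreal e"
    using e by (simp add: ennreal_of_nat_eq_real_of_nat)
qed

text \<open>
  The diameters are replaced by slightly larger \<open>d i\<close>, since sets of diameter \<open>0\<close> would spoil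
  the negative powers of \<open>d i\<close> above; raising \<open>s\<close> to \<open>s'\<close> disposes of the case \<open>s = 0\<close>.
\<close>

lemma hausdorff_measure_null_cover:
  fixes E :: "'a::metric_space set"
  assumes "hausdorff_measure s E = 0" "s \<ge> 0" "s' \<ge> s" "s' > 0" "e > 0"
  obtains U :: "nat \<Rightarrow> 'a set" and d :: "nat \<Rightarrow> real"
  where "E \<subseteq> (\<Union>i. U i)" "\<And>i. d i > 0" "\<And>i x y. x \<in> U i \<Longrightarrow> y \<in> U i \<Longrightarrow> dist x y \<le> d i"
    "summable (\<lambda>i. d i powr s')" "(\<Sum>i. d i powr s') < e"
proof -
  \<comment> \<open>With diameters at most 1, replacing s by the larger s' does not increase the
    sum.\<close>
  have "hausdorff_content s 1 E = 0"
    using assms(1) unfolding hausdorff_measure_def by (metis SUP_upper greaterThan_iff le_zero_eq zero_less_one)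
  then have "hausdorff_content s 1 E < ennreal (min 1 (e / 2))" using assms(5) by simp
  then obtain U where U: "E \<subseteq> (\<Union>i. U i)" "\<And>i. bounded (U i)" "\<And>i. diameter (U i) \<le> 1"
    "(\<Sum>i. diameter_powr s (U i)) < ennreal (min 1 (e / 2))"
    by (rule hausdorff_content_lessD) blast
  define a where "a i = (if U i = {} then 0 else diameter (U i) powr s')" for i
  have a0: "a i \<ge> 0" for i by (simp add: a_def)
  have "ennreal (a i) \<le> diameter_powr s (U i)" for i
    using U(3)[of i] diameter_ge_0[OF U(2)[of i]] assms(2-4)
    by (auto simp: a_def diameter_powr_def powr_le1 intro!: ennreal_leI powr_mono')
  then have "(\<Sum>i. ennreal (a i)) \<le> (\<Sum>i. diameter_powr s (U i))"
    by (intro suminf_le) auto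
  then have less: "(\<Sum>i. ennreal (a i)) < ennreal (min 1 (e / 2))" using U(4) by simp
  then have suma: "summable a"
    using a0 by (intro summable_suminf_not_top) auto
  then have "ennreal (suminf a) < ennreal (min 1 (e / 2))"
    using less a0 by (simp add: suminf_ennreal2)
  then have suma': "suminf a < e / 2" using assms(5) by (simp add: ennreal_less_iff suma a0 suminf_nonneg)
  \<comment> \<open>The enlargement is made on the level of s'-th powers, where it adds exactly e /
    2 to the sum.\<close>
  define d where "d i = (a i + e / 2 * (1 / 2) ^ Suc i) powr (1 / s')" for i
  have pos: "a i + e / 2 * (1 / 2) ^ Suc i > 0" for i
    using a0[of i] assms(5) by (intro add_nonneg_pos) auto
  have ds: "d i powr s' = a i + e / 2 * (1 / 2) ^ Suc i" for i
    using pos[of i] assms(4) by (simp add: d_def powr_powr)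
  have sums: "(\<lambda>i. d i powr s') sums (suminf a + e / 2 * 1)"
    unfolding ds by (intro sums_add summable_sums[OF suma] sums_mult power_half_series)
  show thesis
  proof
    show "E \<subseteq> (\<Union>i. U i)" by (rule U)
    show "d i > 0" for i using pos[of i] by (simp add: d_def)
    show "summable (\<lambda>i. d i powr s')" "(\<Sum>i. d i powr s') < e"
      using sums suma' by (auto simp: sums_iff)
    show "dist x y \<le> d i" if "x \<in> U i" "y \<in> U i" for i x y
    proof -
      have "dist x y \<le> diameter (U i)" using diameter_bounded_bound[OF U(2) that] .
      also have "\<dots> = (a i) powr (1 / s')"
        using that diameter_ge_0[OF U(2)[of i]] assms(4) by (auto simp: a_def powr_powr)
      also have "\<dots> \<le> d i"
        unfolding d_def using a0[of i] assms(4,5) by (intro powr_mono2) auto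
      finally show ?thesis .
    qed
  qed
qed

subsection \<open>Smoothness on the dyadic grid\<close>

lemma cbox_facet_cart:
  fixes a b :: "real ^ 'n"
  assumes ab: "\<And>m. a $ m < b $ m" and c: "c = a $ j \<or> c = b $ j"
  shows "(cbox a b \<inter> {x. x $ j = c}) facet_of cbox a b"
proof -
  let ?H = "{x :: real ^ 'n. axis j 1 \<bullet> x = c}"
  have H: "{x :: real ^ 'n. x $ j = c} = ?H"
    by (simp add: inner_axis inner_commute)
  have face: "(cbox a b \<inter> ?H) face_of cbox a b"
  proof (cases "c = a $ j")
    case True
    then show ?thesis
      by (intro face_of_Int_supporting_hyperplane_ge) (auto simp: mem_box_cart inner_axis inner_commute)
  next
    case False
    with c show ?thesis
      by (intro face_of_Int_supporting_hyperplane_le) (auto simp: mem_box_cart inner_axis inner_commute)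
  qed
  \<comment> \<open>The midpoint of the slice, and an open set constraining only the other
    coordinates: the slice contains a nonempty relatively open piece of the hyperplane, which gives
    it dimension n - 1.\<close>
  define y where "y = (\<chi> m. if m = j then c else (a $ m + b $ m) / 2)"
  define U where "U = (\<Inter>m\<in>UNIV - {j}. {x :: real ^ 'n. a $ m < x $ m} \<inter> {x. x $ m < b $ m})"
  have "open U"
    unfolding U_def by (intro open_INT ballI open_Int open_halfspace_component_gt_cart open_halfspace_component_lt_cart) auto
  have y: "y \<in> U \<inter> ?H"
    using ab by (auto simp: U_def y_def inner_axis inner_commute field_simps)
  have UH: "U \<inter> ?H \<subseteq> cbox a b"
  proof
    fix x assume "x \<in> U \<inter> ?H"
    then have "x $ j = c" "\<And>m. m \<noteq> j \<Longrightarrow> a $ m < x $ m \<and> x $ m < b $ m"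
      by (auto simp: U_def inner_axis inner_commute)
    then show "x \<in> cbox a b"
      using ab[of j] c by (simp add: mem_box_cart) (metis less_imp_le order_refl)
  qed
  have "aff_dim ?H = DIM(real ^ 'n) - 1"
    by (rule aff_dim_hyperplane) (simp add: axis_eq_0_iff)
  moreover have "aff_dim (U \<inter> ?H) = aff_dim ?H"
    using \<open>open U\<close> y by (intro aff_dim_convex_Int_open[of ?H U, unfolded Int_commute[of ?H]]) (auto simp: convex_hyperplane)
  moreover have "aff_dim (U \<inter> ?H) \<le> aff_dim (cbox a b \<inter> ?H)" "aff_dim (cbox a b \<inter> ?H) \<le> aff_dim ?H"
    using UH by (intro aff_dim_subset; blast)+
  moreover have "aff_dim (cbox a b) = DIM(real ^ 'n)"
    using ab interval_ne_empty_cart(2)[of a b] by (intro aff_dim_nonempty_interior) (simp add: interior_cbox)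
  ultimately have "aff_dim (cbox a b \<inter> ?H) = aff_dim (cbox a b) - 1" by simp
  moreover have "cbox a b \<inter> ?H \<noteq> {}" using UH y by blast
  ultimately show ?thesis unfolding facet_of_def H using face by blast
qed

lemma dyadic_box_eq_cube:
  "dyadic_box k i = cube (\<chi> j. (of_int (i $ j) + 1 / 2) / 2 ^ k) (1 / 2 ^ k)"
proof -
  have "(\<chi> j. (of_int (i $ j) + 1 / 2) / 2 ^ k) - vec (1 / 2 ^ k / 2) = ((\<chi> j. of_int (i $ j) / 2 ^ k) :: real ^ 'a)"
    "(\<chi> j. (of_int (i $ j) + 1 / 2) / 2 ^ k) + vec (1 / 2 ^ k / 2) = ((\<chi> j. (of_int (i $ j) + 1) / 2 ^ k) :: real ^ 'a)"
    by (simp_all add: vec_eq_iff field_simps)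
  then show ?thesis by (simp only: cube_def dyadic_box_def)
qed

lemma consecutive_dyadic_boxes:
  "consecutive_cubes (dyadic_box k i) (dyadic_box k (i + axis j 1)) (1 / 2 ^ k)"
proof -
  let ?a = "\<lambda>i. (\<chi> j. of_int (i $ j) / 2 ^ k) :: real ^ 'a"
  let ?b = "\<lambda>i. (\<chi> j. (of_int (i $ j) + 1) / 2 ^ k) :: real ^ 'a"
  let ?i = "i + axis j 1"
  let ?c = "(of_int (i $ j) + 1) / 2 ^ k :: real"
  have c: "x $ j = ?c \<longleftrightarrow> 2 ^ k * x $ j = of_int (i $ j) + 1" for x :: "real ^ 'a"
    by (simp add: field_simps)
  have i': "of_int (?i $ m) = of_int (i $ m) + (if m = j then 1 else 0 :: real)" for m
    by (simp add: axis_def)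
  have both: "x \<in> dyadic_box k i \<and> x \<in> dyadic_box k ?i \<Longrightarrow> x $ j = ?c" for x
    unfolding mem_dyadic_box c i' by (auto dest!: spec[of _ j])
  have same: "x \<in> dyadic_box k i \<longleftrightarrow> x \<in> dyadic_box k ?i" if "x $ j = ?c" for x
    using that unfolding mem_dyadic_box c i' by (intro iff_allI) auto
  have eq1: "dyadic_box k i \<inter> dyadic_box k ?i = dyadic_box k i \<inter> {x. x $ j = ?c}"
    using both same by blast
  have eq2: "dyadic_box k i \<inter> dyadic_box k ?i = dyadic_box k ?i \<inter> {x. x $ j = ?c}"
    using both same by blast
  have "(dyadic_box k i \<inter> dyadic_box k ?i) facet_of dyadic_box k i"
    unfolding eq1 unfolding dyadic_box_def by (rule cbox_facet_cart) (auto simp: divide_strict_right_mono)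
  moreover have "(dyadic_box k i \<inter> dyadic_box k ?i) facet_of dyadic_box k ?i"
    unfolding eq2 unfolding dyadic_box_def by (rule cbox_facet_cart) (auto simp: divide_strict_right_mono axis_def)
  moreover have "closure (dyadic_box k i) = dyadic_box k i" for i :: "int ^ 'a"
    by (simp add: dyadic_box_def closure_closed)
  ultimately show ?thesis
    unfolding consecutive_cubes_def using dyadic_box_eq_cube by fastforce
qed

lemma cube_density_dyadic_box:
  "A \<in> sets lebesgue \<Longrightarrow> cube_density A (dyadic_box k i) = dyadic_density A k i"
  by (simp add: cube_density_def dyadic_density_def measure_Int_dyadic_box measure_dyadic_box)

lemma smooth_set_dyadic_density_diff:
  fixes A :: "(real ^ 'n) set"
  assumes A: "smooth_set A" and e: "e > 0"
  shows "\<forall>\<^sub>F k in sequentially. \<forall>i j. \<bar>dyadic_density A k (i + axis j 1) - dyadic_density A k i\<bar> < e"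
proof -
  let ?S = "\<lambda>\<delta>. {(Q, Q'). \<exists>l\<le>\<delta>. consecutive_cubes Q Q' l} :: ((real ^ 'n) set \<times> (real ^ 'n) set) set"
  let ?f = "\<lambda>(Q, Q'). \<bar>cube_density A Q - cube_density A Q'\<bar>"
  have As: "A \<in> sets lebesgue" using A by (simp add: smooth_set_def)
  have dens: "0 \<le> cube_density A (cube x l)" "cube_density A (cube x l) \<le> 1" for x l
  proof -
    have "measure lebesgue (A \<inter> cube x l) \<le> measure lebesgue (cube x l)"
      using As by (intro measure_mono_fmeasurable) (auto simp: cube_def)
    then show "0 \<le> cube_density A (cube x l)" "cube_density A (cube x l) \<le> 1"
      by (auto simp: cube_density_def divide_le_eq_1 zero_less_measure_iff)
  qed
  \<comment> \<open>A real-valued supremum dominates its members only if they are bounded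
    above.\<close>
  have bdd: "bdd_above (?f ` ?S \<delta>)" for \<delta>
  proof (rule bdd_aboveI2)
    fix q assume "q \<in> ?S \<delta>"
    then obtain x y l where "q = (cube x l, cube y l)" by (auto simp: consecutive_cubes_def)
    then show "?f q \<le> 1" using dens[of x l] dens[of y l] by auto
  qed
  have "\<forall>\<^sub>F \<delta> in at_right 0. (SUP q\<in>?S \<delta>. ?f q) < e"
    using A e unfolding smooth_set_def by (auto elim: order_tendstoD)
  then obtain b where b: "b > 0" "\<And>\<delta>. 0 < \<delta> \<Longrightarrow> \<delta> < b \<Longrightarrow> (SUP q\<in>?S \<delta>. ?f q) < e"
    unfolding eventually_at_right_field by auto
  show ?thesis
    using eventually_divide_power2_less[OF b(1), of 1]
  proof eventually_elim
    case (elim k)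
    show ?case
    proof (intro allI)
      fix i :: "int ^ 'n" and j
      have "?f (dyadic_box k i, dyadic_box k (i + axis j 1)) \<le> (SUP q\<in>?S (1 / 2 ^ k). ?f q)"
        using consecutive_dyadic_boxes[of k i j] by (intro cSUP_upper bdd) auto
      also have "\<dots> < e" using b(2)[of "1 / 2 ^ k"] elim by simp
      finally show "\<bar>dyadic_density A k (i + axis j 1) - dyadic_density A k i\<bar> < e"
        using As by (simp add: cube_density_dyadic_box abs_minus_commute)
    qed
  qed
qed

text \<open>The supremum over all later generations is monotone, and the added 1 / 2^k makes it
  strictly positive. Positivity matters: excursions are measured in terms of \<omega> and must not
  have length 0.\<close>

lemma antimono_modulus_exists:
  fixes g :: "nat \<Rightarrow> 'a \<Rightarrow> real"
  assumes bound: "\<And>k x. \<bar>g k x\<bar> \<le> B"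
    and small: "\<And>e. e > 0 \<Longrightarrow> \<forall>\<^sub>F k in sequentially. \<forall>x. \<bar>g k x\<bar> < e"
  obtains \<omega> where "\<And>k. \<omega> k > 0" "\<And>k l. k \<le> l \<Longrightarrow> \<omega> l \<le> \<omega> k" "\<omega> \<longlonglongrightarrow> 0" "\<And>k x. \<bar>g k x\<bar> \<le> \<omega> k"
proof -
  define S where "S k = (\<lambda>(l, x). \<bar>g l x\<bar>) ` ({k..} \<times> UNIV)" for k
  define \<omega> where "\<omega> k = Sup (S k) + 1 / 2 ^ k" for k
  have bdd: "bdd_above (S k)" for k
    using bound by (auto simp: S_def intro!: bdd_aboveI2)
  have ne: "S k \<noteq> {}" for k by (auto simp: S_def)
  have ge: "\<bar>g l x\<bar> \<le> Sup (S k)" if "k \<le> l" for k l x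
    using that by (intro cSup_upper bdd) (auto simp: S_def image_iff)
  have pos: "\<omega> k > 0" for k
    unfolding \<omega>_def using order_trans[OF abs_ge_zero ge[of k k undefined]] by (intro add_nonneg_pos) auto
  show thesis
  proof
    show "\<omega> k > 0" for k by (rule pos)
    show "\<omega> l \<le> \<omega> k" if "k \<le> l" for k l
    proof -
      have "Sup (S l) \<le> Sup (S k)"
        using that by (intro cSup_subset_mono ne bdd) (auto simp: S_def)
      moreover have "1 / 2 ^ l \<le> (1 / 2 ^ k :: real)"
        using that by (intro divide_left_mono power_increasing) auto
      ultimately show ?thesis by (simp add: \<omega>_def)
    qed
    show "\<bar>g k x\<bar> \<le> \<omega> k" for k x
      using ge[of k k x] by (simp add: \<omega>_def add_increasing2)
    show "\<omega> \<longlonglongrightarrow> 0"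
    proof (rule order_tendstoI)
      show "\<forall>\<^sub>F k in sequentially. a < \<omega> k" if "a < 0" for a
        using less_trans[OF that pos] by simp
      fix e :: real assume e: "0 < e"
      obtain K where K: "\<And>k x. k \<ge> K \<Longrightarrow> \<bar>g k x\<bar> < e / 2"
        using small[of "e / 2"] e unfolding eventually_sequentially by auto
      have "\<forall>\<^sub>F k in sequentially. 1 / 2 ^ k < e / 2"
        using eventually_divide_power2_less[of "e / 2" 1] e by simp
      then show "\<forall>\<^sub>F k in sequentially. \<omega> k < e"
        using eventually_ge_at_top[of K]
      proof eventually_elim
        case (elim k)
        have "Sup (S k) \<le> e / 2"
        proof (rule cSup_least[OF ne])
          fix y assume "y \<in> S k"
          then obtain l x where "y = \<bar>g l x\<bar>" "k \<le> l" by (auto simp: S_def)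
          then show "y \<le> e / 2" using K[of l x] elim(2) by simp
        qed
        then show ?case using elim(1) by (simp add: \<omega>_def)
      qed
    qed
  qed
qed

text \<open>Walk from i to i' by unit steps along the axes; induction on the l1 distance.\<close>

lemma int_grid_Lipschitz:
  fixes f :: "int ^ 'n \<Rightarrow> real"
  assumes step: "\<And>i j. \<bar>f (i + axis j 1) - f i\<bar> \<le> w"
  shows "\<bar>f i - f i'\<bar> \<le> w * (\<Sum>j\<in>UNIV. \<bar>of_int (i $ j - i' $ j)\<bar>)"
proof (induction "nat (\<Sum>j\<in>UNIV. \<bar>i $ j - i' $ j\<bar>)" arbitrary: i rule: less_induct)
  case less
  let ?S = "\<lambda>i. \<Sum>j\<in>UNIV. \<bar>i $ j - i' $ j\<bar>"
  have S_real: "(\<Sum>j\<in>UNIV. \<bar>of_int (i $ j - i' $ j)\<bar>) = real_of_int (?S i)" for i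
    by simp
  show ?case
  proof (cases "i = i'")
    case False
    then obtain j where j: "i $ j \<noteq> i' $ j" by (auto simp: vec_eq_iff)
    define i2 where "i2 = (if i $ j < i' $ j then i + axis j 1 else i - axis j 1)"
    have "\<bar>f i2 - f i\<bar> \<le> w"
      using step[of i j] step[of "i - axis j 1" j] by (auto simp: i2_def abs_minus_commute)
    moreover have S2: "?S i2 = ?S i - 1"
    proof -
      have "?S i2 = \<bar>i2 $ j - i' $ j\<bar> + (\<Sum>m\<in>UNIV - {j}. \<bar>i2 $ m - i' $ m\<bar>)"
        by (rule sum.remove) auto
      also have "(\<Sum>m\<in>UNIV - {j}. \<bar>i2 $ m - i' $ m\<bar>) = (\<Sum>m\<in>UNIV - {j}. \<bar>i $ m - i' $ m\<bar>)"
        by (intro sum.cong) (auto simp: i2_def axis_def)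
      also have "\<bar>i2 $ j - i' $ j\<bar> = \<bar>i $ j - i' $ j\<bar> - 1"
        using j by (auto simp: i2_def)
      also have "\<bar>i $ j - i' $ j\<bar> - 1 + (\<Sum>m\<in>UNIV - {j}. \<bar>i $ m - i' $ m\<bar>) = ?S i - 1"
        by (subst (2) sum.remove[of _ j]) auto
      finally show ?thesis .
    qed
    moreover have "?S i2 \<ge> 0" by (intro sum_nonneg) auto
    ultimately have "\<bar>f i2 - f i'\<bar> \<le> w * (\<Sum>j\<in>UNIV. \<bar>of_int (i2 $ j - i' $ j)\<bar>)"
      by (intro less) simp
    then have "\<bar>f i2 - f i'\<bar> \<le> w * of_int (?S i2)"
      unfolding S_real .
    then show ?thesis
      using \<open>\<bar>f i2 - f i\<bar> \<le> w\<close> unfolding S_real S2 by (simp add: algebra_simps)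
  qed simp
qed

text \<open>Otherwise the substitute for the density theorem would make A null in every
  ball.\<close>

lemma dyadic_density_exceeds:
  fixes A :: "(real ^ 'n) set"
  assumes A: "A \<in> sets lebesgue" "emeasure lebesgue A > 0" and \<alpha>: "\<alpha> < 1"
  shows "\<exists>k i. \<alpha> < dyadic_density A k i"
proof (rule ccontr)
  assume "\<not> ?thesis"
  then have le: "dyadic_density A k i \<le> \<alpha>" for k i by (meson not_le)
  have "emeasure lebesgue (A \<inter> cball 0 (real m)) = 0" for m
  proof -
    have "measure lebesgue (A \<inter> cball 0 (real m)) = 0"
      by (rule negligible_if_dyadic_density_le[OF A(1) _ _ \<alpha>, of _ 0]) (auto simp: le)
    moreover have "A \<inter> cball 0 (real m) \<in> lmeasurable"
      using A(1) by (intro fmeasurable_Int_sets) auto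
    ultimately show ?thesis by (simp add: emeasure_eq_measure2)
  qed
  then have "emeasure lebesgue (\<Union>m. A \<inter> cball 0 (real m)) = 0"
    using A(1) by (intro emeasure_UN_eq_0) auto
  moreover have "(\<Union>m. A \<inter> cball 0 (real m)) = A"
    using real_arch_simple by auto
  ultimately show False using A(2) by simp
qed

lemma dyadic_density_le_of_finer:
  fixes A :: "(real ^ 'n) set"
  assumes A: "A \<in> sets lebesgue" and k: "k \<le> m"
    and le: "\<And>x. x \<in> dyadic k i \<Longrightarrow> dyadic_density A m (grid_index m x) \<le> b"
  shows "dyadic_density A k i \<le> b"
  using measure_Int_saturated_le[OF saturated_dyadic[OF k] bounded_dyadic A le]
    dyadic_vol_pos[where 'n = 'n and k = k]
  by (simp add: dyadic_density_def measure_dyadic divide_le_eq)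

lemma dyadic_density_ge_of_finer:
  fixes A :: "(real ^ 'n) set"
  assumes A: "A \<in> sets lebesgue" and k: "k \<le> m"
    and le: "\<And>x. x \<in> dyadic k i \<Longrightarrow> b \<le> dyadic_density A m (grid_index m x)"
  shows "b \<le> dyadic_density A k i"
  using measure_Int_saturated_ge[OF saturated_dyadic[OF k] bounded_dyadic A le]
    dyadic_vol_pos[where 'n = 'n and k = k]
  by (simp add: dyadic_density_def measure_dyadic le_divide_eq)

text \<open>What remains of smoothness in the rest of the argument: adjacent dyadic cubes of one
  generation are compared, with a single monotone modulus for all later generations.\<close>

locale dyadic_smooth =
  fixes A :: "(real ^ 'n) set" and \<omega> :: "nat \<Rightarrow> real"
  assumes A: "A \<in> sets lebesgue"
    and \<omega>_pos: "\<And>k. \<omega> k > 0"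
    and \<omega>_antimono: "\<And>k l. k \<le> l \<Longrightarrow> \<omega> l \<le> \<omega> k"
    and \<omega>_lim: "\<omega> \<longlonglongrightarrow> 0"
    and neighbour: "\<And>k i j. \<bar>dyadic_density A k (i + axis j 1) - dyadic_density A k i\<bar> \<le> \<omega> k"
begin

section \<open>Oscillation of the density within and between generations\<close>

lemma density_diff_le:
  assumes "\<And>j. \<bar>x $ j - y $ j\<bar> \<le> r"
  shows "\<bar>dyadic_density A m (grid_index m x) - dyadic_density A m (grid_index m y)\<bar>
    \<le> \<omega> m * (real CARD('n) * (2 ^ m * r + 1))"
proof -
  \<comment> \<open>The summand 1 is the error of rounding to integer parts.\<close>
  have "\<bar>real_of_int (grid_index m x $ j - grid_index m y $ j)\<bar> \<le> 2 ^ m * r + 1" for j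
  proof -
    have "\<bar>2 ^ m * x $ j - 2 ^ m * y $ j\<bar> \<le> 2 ^ m * r"
      using assms[of j] by (simp add: right_diff_distrib[symmetric] abs_mult)
    then show ?thesis unfolding grid_index_def by simp linarith
  qed
  then have "(\<Sum>j\<in>UNIV. \<bar>real_of_int (grid_index m x $ j - grid_index m y $ j)\<bar>) \<le> real CARD('n) * (2 ^ m * r + 1)"
    using sum_bounded_above[of "UNIV :: 'n set" "\<lambda>j. \<bar>real_of_int (grid_index m x $ j - grid_index m y $ j)\<bar>" "2 ^ m * r + 1"]
    by simp
  then have "\<omega> m * (\<Sum>j\<in>UNIV. \<bar>real_of_int (grid_index m x $ j - grid_index m y $ j)\<bar>) \<le> \<omega> m * (real CARD('n) * (2 ^ m * r + 1))"
    using \<omega>_pos[of m] by (intro mult_left_mono) auto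
  then show ?thesis
    using int_grid_Lipschitz[of "dyadic_density A m" "\<omega> m" "grid_index m x" "grid_index m y"] neighbour by (meson order_trans)
qed

text \<open>The coarse density is the average of the fine ones, each close to the one at z. The
  point z may lie outside the coarse cube, which the comparison with images of cubes
  exploits.\<close>

lemma density_coarse_fine_diff_le:
  assumes k: "k \<le> m" and r: "\<And>x j. x \<in> dyadic k i \<Longrightarrow> \<bar>x $ j - z $ j\<bar> \<le> r"
  shows "\<bar>dyadic_density A k i - dyadic_density A m (grid_index m z)\<bar> \<le> \<omega> m * (real CARD('n) * (2 ^ m * r + 1))"
proof -
  let ?c = "dyadic_density A m (grid_index m z)" and ?e = "\<omega> m * (real CARD('n) * (2 ^ m * r + 1))"
  have "\<bar>dyadic_density A m (grid_index m x) - ?c\<bar> \<le> ?e" if "x \<in> dyadic k i" for x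
    using density_diff_le[OF r[OF that]] .
  then have "dyadic_density A k i \<le> ?c + ?e" "?c - ?e \<le> dyadic_density A k i"
    by (intro dyadic_density_le_of_finer[OF A k] dyadic_density_ge_of_finer[OF A k]; force simp: abs_le_iff)+
  then show ?thesis by simp
qed

lemma density_jump_le:
  assumes "k \<le> m"
  shows "\<bar>dyadic_density A (Suc m) (grid_index (Suc m) x) - dyadic_density A m (grid_index m x)\<bar>
    \<le> 3 * real CARD('n) * \<omega> k"
proof -
  have "\<bar>dyadic_density A m (grid_index m x) - dyadic_density A (Suc m) (grid_index (Suc m) x)\<bar>
      \<le> \<omega> (Suc m) * (real CARD('n) * (2 ^ Suc m * (1 / 2 ^ m) + 1))"
  proof (rule density_coarse_fine_diff_le)
    fix z j assume "z \<in> dyadic m (grid_index m x)"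
    then show "\<bar>z $ j - x $ j\<bar> \<le> 1 / 2 ^ m"
      using dyadic_subset_box[of m "grid_index m x"] mem_dyadic_index[of x m] by (intro dyadic_box_component_diff) auto
  qed simp
  \<comment> \<open>The 3 is 2^(m+1) * 2^-m + 1.\<close>
  also have "\<dots> = 3 * real CARD('n) * \<omega> (Suc m)" by simp
  also have "\<dots> \<le> 3 * real CARD('n) * \<omega> k"
    using assms \<omega>_antimono[of k "Suc m"] by (intro mult_left_mono) auto
  finally show ?thesis by (simp add: abs_minus_commute)
qed

text \<open>A discrete intermediate value theorem: if all densities were further than \<omega> k
  from \<alpha>, adjacent cubes would lie on the same side of \<alpha>, so the indicator f would be
  constant on the grid. But densities on both sides occur in all generations beyond k1 and
  k2.\<close>

lemma density_near_exists:
  assumes "emeasure lebesgue A > 0" "emeasure lebesgue (- A) > 0" "0 < \<alpha>" "\<alpha> < 1"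
  shows "\<forall>\<^sub>F k in sequentially. \<exists>i. \<bar>dyadic_density A k i - \<alpha>\<bar> \<le> \<omega> k"
proof -
  have nA: "- A \<in> sets lebesgue"
    using sets.compl_sets[OF A] by (simp add: Compl_eq_Diff_UNIV)
  obtain k1 i1 where 1: "\<alpha> < dyadic_density A k1 i1"
    using dyadic_density_exceeds[OF A assms(1,4)] by blast
  obtain k2 i2 where "1 - \<alpha> < dyadic_density (- A) k2 i2"
    using dyadic_density_exceeds[OF nA assms(2), of "1 - \<alpha>"] assms(3) by auto
  then have 2: "dyadic_density A k2 i2 < \<alpha>" using A by (simp add: dyadic_density_Compl)
  show ?thesis
    using eventually_ge_at_top[of "max k1 k2"]
  proof eventually_elim
    case (elim k)
    obtain x where x: "\<alpha> < dyadic_density A k (grid_index k x)"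
      using dyadic_density_le_of_finer[OF A, of k1 k i1 \<alpha>] 1 elim by (meson max.bounded_iff not_le)
    obtain y where y: "dyadic_density A k (grid_index k y) < \<alpha>"
      using dyadic_density_ge_of_finer[OF A, of k2 k i2 \<alpha>] 2 elim by (meson max.bounded_iff not_le)
    show ?case
    proof (rule ccontr)
      assume far: "\<not> ?case"
      define f where "f i = (if dyadic_density A k i > \<alpha> then 1 else 0 :: real)" for i
      have "\<bar>f (i + axis j 1) - f i\<bar> \<le> 0" for i j
      proof -
        have "\<bar>dyadic_density A k i - \<alpha>\<bar> > \<omega> k" using far by (meson not_le)
        then show ?thesis using neighbour[of k i j] by (auto simp: f_def)
      qed
      from int_grid_Lipschitz[OF this, of "grid_index k x" "grid_index k y"]
      show False using x y by (simp add: f_def)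
    qed
  qed
qed

text \<open>
  Steps of size \<open>\<eta>\<close> versus excursions of size \<open>\<surd>\<eta>\<close>: the excursions still tend to \<open>0\<close>, but last
  at least \<open>1 / \<surd>\<eta>\<close> generations, which makes the cubes of a \<open>return_family\<close> arbitrarily small relative
  to their parent.
\<close>

definition scale :: "nat \<Rightarrow> real" where
  "scale k = sqrt (3 * real CARD('n) * \<omega> k)"

lemma scale_pos: "scale k > 0"
  using \<omega>_pos by (simp add: scale_def)

lemma scale_square: "scale k * scale k = 3 * real CARD('n) * \<omega> k"
  using \<omega>_pos[of k] by (simp add: scale_def)

lemma scale_lim: "scale \<longlonglongrightarrow> 0"
proof -
  have "(\<lambda>k. sqrt (3 * real CARD('n) * \<omega> k)) \<longlonglongrightarrow> sqrt (3 * real CARD('n) * 0)"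
    by (intro tendsto_intros \<omega>_lim)
  then show ?thesis by (simp add: scale_def[abs_def])
qed

lemma scale_eventually_less: "e > 0 \<Longrightarrow> \<forall>\<^sub>F k in sequentially. scale k < e"
  using scale_lim by (rule order_tendstoD)

text \<open>The first clause bounds the deviation of the child by the scale of its parent only. The
  second controls every generation in between, in terms of the deviation of the parent, which the
  first clause bounds one step earlier in the branch. Together they give convergence along all
  generations and not only at the nodes.\<close>

definition return_to :: "real \<Rightarrow> nat \<times> (int ^ 'n) \<Rightarrow> nat \<times> (int ^ 'n) \<Rightarrow> bool" where
  "return_to \<alpha> q q' \<longleftrightarrow>
     \<bar>dyadic_density A (fst q') (snd q') - \<alpha>\<bar> \<le> 2 * scale (fst q) \<and>
     (\<forall>l. fst q \<le> l \<and> l \<le> fst q' \<longrightarrow> (\<exists>i. dyadic (fst q') (snd q') \<subseteq> dyadic l i \<and>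
        \<bar>dyadic_density A l i - \<alpha>\<bar> \<le> 2 * \<bar>dyadic_density A (fst q) (snd q) - \<alpha>\<bar> + 2 * scale (fst q)))"

lemma return_family:
  fixes k :: nat and i :: "int ^ 'n"
  defines "D \<equiv> dyadic_density A k i"
  assumes sc: "scale k \<le> 1" "scale k * real N \<le> 1"
    and low: "\<bar>D - \<alpha>\<bar> + scale k < D" and up: "D + (\<bar>D - \<alpha>\<bar> + scale k) < 1"
  shows "\<exists>F. finite F \<and>
       (\<forall>q'\<in>F. \<forall>q''\<in>F. q' \<noteq> q'' \<longrightarrow> dyadic (fst q') (snd q') \<inter> dyadic (fst q'') (snd q'') = {}) \<and>
       (\<forall>q'\<in>F. return_to \<alpha> (k, i) q' \<and> k + N \<le> fst q' \<and> dyadic (fst q') (snd q') \<subseteq> dyadic k i) \<and>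
       dyadic_vol TYPE('n) k \<le> 4 * (\<Sum>q'\<in>F. dyadic_vol TYPE('n) (fst q'))"
proof -
  define \<eta> where "\<eta> = 3 * real CARD('n) * \<omega> k"
  \<comment> \<open>For D \<ge> \<alpha> the exit level D - t is then \<alpha> -
    \<open>scale k\<close>: just beyond \<alpha>, and at distance at least \<open>scale k\<close>
    from D.\<close>
  define t where "t = \<bar>D - \<alpha>\<bar> + scale k"
  have \<eta>: "0 < \<eta>" "\<eta> = scale k * scale k" "\<eta> \<le> scale k" "\<eta> \<le> t"
  proof -
    show "0 < \<eta>" using \<omega>_pos by (simp add: \<eta>_def)
    show eq: "\<eta> = scale k * scale k" by (simp add: \<eta>_def scale_square)
    show "\<eta> \<le> scale k" unfolding eq using sc(1) scale_pos[of k] by (simp add: mult_left_le_one_le)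
    then show "\<eta> \<le> t" by (simp add: t_def)
  qed
  have nA: "- A \<in> sets lebesgue"
    using sets.compl_sets[OF A] by (simp add: Compl_eq_Diff_UNIV)
  \<comment> \<open>A distance of at least \<open>scale k\<close>, covered in steps of size
    \<open>scale k\<close> squared, takes at least 1 / \<open>scale k\<close> generations, hence at
    least N.\<close>
  have levels: "k + N \<le> m" if "k \<le> m" "t \<le> real (m - k) * \<eta>" for m
  proof -
    have "scale k * 1 \<le> scale k * (real (m - k) * scale k)"
      using that(2) by (simp add: t_def \<eta>(2) mult_ac)
    then have "1 \<le> real (m - k) * scale k"
      using scale_pos[of k] mult_le_cancel_left_pos[of "scale k" 1 "real (m - k) * scale k"] by blast
    then have "scale k * real N \<le> scale k * real (m - k)" using sc(2) by (metis mult.commute order_trans)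
    then have "real N \<le> real (m - k)"
      using scale_pos[of k] mult_le_cancel_left_pos[of "scale k" "real N" "real (m - k)"] by blast
    then show ?thesis using that(1) by linarith
  qed
  obtain F :: "(nat \<times> (int ^ 'n)) set" where F: "finite F"
    "\<And>q q'. q \<in> F \<Longrightarrow> q' \<in> F \<Longrightarrow> q \<noteq> q' \<Longrightarrow> dyadic (fst q) (snd q) \<inter> dyadic (fst q') (snd q') = {}"
    "\<And>m j. (m, j) \<in> F \<Longrightarrow> k \<le> m \<and> t \<le> real (m - k) * \<eta> \<and> dyadic m j \<subseteq> dyadic k i \<and>
       \<bar>dyadic_density A m j - \<alpha>\<bar> \<le> scale k + \<eta> \<and>
       (\<forall>l. k \<le> l \<and> l \<le> m \<longrightarrow>
         (\<exists>i'. dyadic m j \<subseteq> dyadic l i' \<and> \<bar>dyadic_density A l i' - D\<bar> \<le> t + \<eta>))"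
    "dyadic_vol TYPE('n) k \<le> 4 * (\<Sum>q\<in>F. dyadic_vol TYPE('n) (fst q))"
  proof (cases "\<alpha> \<le> D")
    case True
    have jump: "\<bar>dyadic_density A (Suc m) (grid_index (Suc m) x) - dyadic_density A m (grid_index m x)\<bar> \<le> \<eta>"
      if "k \<le> m" for m x
      using density_jump_le[OF that, of x] by (simp add: \<eta>_def)
    have low': "0 < D - t" and up': "D + t < 1" using low up by (auto simp: t_def)
    obtain F :: "(nat \<times> (int ^ 'n)) set" where F: "finite F"
      "\<And>q q'. q \<in> F \<Longrightarrow> q' \<in> F \<Longrightarrow> q \<noteq> q' \<Longrightarrow> dyadic (fst q) (snd q) \<inter> dyadic (fst q') (snd q') = {}"
      "\<And>m j. (m, j) \<in> F \<Longrightarrow> k \<le> m \<and> t \<le> real (m - k) * \<eta> \<and> dyadic m j \<subseteq> dyadic k i \<and>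
         D - t - \<eta> \<le> dyadic_density A m j \<and> dyadic_density A m j \<le> D - t \<and>
         (\<forall>l. k \<le> l \<and> l \<le> m \<longrightarrow>
           (\<exists>i'. dyadic m j \<subseteq> dyadic l i' \<and> \<bar>dyadic_density A l i' - D\<bar> \<le> t + \<eta>))"
      "dyadic_vol TYPE('n) k \<le> 4 * (\<Sum>q\<in>F. dyadic_vol TYPE('n) (fst q))"
      by (rule stopping_family_down[OF A jump \<eta>(1,4), where i = i and k = k, folded D_def, OF _ low' up']) (assumption, (rule that; assumption))
    have near: "\<bar>dyadic_density A m j - \<alpha>\<bar> \<le> scale k + \<eta>" if "(m, j) \<in> F" for m j
      using F(3)[OF that] True \<eta>(1) scale_pos[of k] by (auto simp: t_def abs_le_iff)
    show thesis
      by (rule that[OF F(1,2) _ F(4)]) (use F(3) near in blast)+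
  next
    \<comment> \<open>Below \<alpha> the excursion must go upwards, which is a downward excursion
      for the complement.\<close>
    case False
    have D': "dyadic_density (- A) k i = 1 - D" by (simp add: dyadic_density_Compl[OF A] D_def)
    have jump': "\<bar>dyadic_density (- A) (Suc m) (grid_index (Suc m) x) - dyadic_density (- A) m (grid_index m x)\<bar> \<le> \<eta>"
      if "k \<le> m" for m x
      using density_jump_le[OF that, of x] by (simp add: dyadic_density_Compl[OF A] \<eta>_def)
    have low': "0 < (1 - D) - t" and up': "(1 - D) + t < 1" using low up by (auto simp: t_def)
    obtain F :: "(nat \<times> (int ^ 'n)) set" where F: "finite F"
      "\<And>q q'. q \<in> F \<Longrightarrow> q' \<in> F \<Longrightarrow> q \<noteq> q' \<Longrightarrow> dyadic (fst q) (snd q) \<inter> dyadic (fst q') (snd q') = {}"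
      "\<And>m j. (m, j) \<in> F \<Longrightarrow> k \<le> m \<and> t \<le> real (m - k) * \<eta> \<and> dyadic m j \<subseteq> dyadic k i \<and>
         (1 - D) - t - \<eta> \<le> dyadic_density (- A) m j \<and> dyadic_density (- A) m j \<le> (1 - D) - t \<and>
         (\<forall>l. k \<le> l \<and> l \<le> m \<longrightarrow>
           (\<exists>i'. dyadic m j \<subseteq> dyadic l i' \<and> \<bar>dyadic_density (- A) l i' - (1 - D)\<bar> \<le> t + \<eta>))"
      "dyadic_vol TYPE('n) k \<le> 4 * (\<Sum>q\<in>F. dyadic_vol TYPE('n) (fst q))"
      by (rule stopping_family_down[OF nA jump' \<eta>(1,4), where i = i and k = k, unfolded D', OF _ low' up']) (assumption, (rule that; assumption))
    have eq: "\<bar>1 - a - (1 - D)\<bar> = \<bar>a - D\<bar>" for a by simp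
    have near: "\<bar>dyadic_density A m j - \<alpha>\<bar> \<le> scale k + \<eta>" if "(m, j) \<in> F" for m j
      using F(3)[OF that] False \<eta>(1) scale_pos[of k] by (auto simp: t_def abs_le_iff dyadic_density_Compl[OF A])
    show thesis
      by (rule that[OF F(1,2) _ F(4)]) (use F(3)[unfolded dyadic_density_Compl[OF A] eq] near in blast)+
  qed
  have ret: "return_to \<alpha> (k, i) (m, j)" if mj: "(m, j) \<in> F" for m j
    unfolding return_to_def fst_conv snd_conv
  proof (intro conjI allI impI)
    show "\<bar>dyadic_density A m j - \<alpha>\<bar> \<le> 2 * scale k" using F(3)[OF mj] \<eta>(3) by linarith
    fix l assume "k \<le> l \<and> l \<le> m"
    then obtain i' where i': "dyadic m j \<subseteq> dyadic l i'" "\<bar>dyadic_density A l i' - D\<bar> \<le> t + \<eta>"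
      using F(3)[OF mj] by blast
    have "\<bar>dyadic_density A l i' - \<alpha>\<bar> \<le> 2 * \<bar>D - \<alpha>\<bar> + 2 * scale k"
      using i'(2) \<eta>(3) abs_triangle_ineq[of "dyadic_density A l i' - D" "D - \<alpha>"] by (simp add: t_def)
    then show "\<exists>i'. dyadic m j \<subseteq> dyadic l i' \<and>
        \<bar>dyadic_density A l i' - \<alpha>\<bar> \<le> 2 * \<bar>dyadic_density A k i - \<alpha>\<bar> + 2 * scale k"
      using i'(1) unfolding D_def by blast
  qed
  show ?thesis
  proof (intro exI conjI ballI impI)
    fix q' assume q': "q' \<in> F"
    obtain m j where mj: "q' = (m, j)" by (cases q')
    show "return_to \<alpha> (k, i) q'" "k + N \<le> fst q'" "dyadic (fst q') (snd q') \<subseteq> dyadic k i"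
      using ret F(3)[of m j] levels[of m] q' by (auto simp: mj)
  qed (use F in auto)
qed

text \<open>
  Closed cubes are needed here because a nested sequence of half-open cubes may have empty
  intersection. The cube \<open>i\<close> may then vary among the neighbours of the one containing \<open>y\<close>.
\<close>

definition closed_dyadic_limit :: "real \<Rightarrow> (real ^ 'n) set" where
  "closed_dyadic_limit \<alpha> = {y. \<forall>e>0. \<forall>\<^sub>F m in sequentially. \<exists>i. y \<in> dyadic_box m i \<and> \<bar>dyadic_density A m i - \<alpha>\<bar> < e}"

lemma return_sequence_limit:
  assumes lev: "\<And>k. fst (q k) < fst (q (Suc k))"
    and ret: "\<And>k. return_to \<alpha> (q k) (q (Suc k))"
    and y: "\<And>k. y \<in> dyadic_box (fst (q k)) (snd (q k))"
  shows "y \<in> closed_dyadic_limit \<alpha>"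
  unfolding closed_dyadic_limit_def
proof (intro CollectI allI impI)
  fix e :: real assume e: "e > 0"
  have smono: "strict_mono (\<lambda>k. fst (q k))" using lev by (simp add: strict_mono_Suc_iff)
  then have ge: "k \<le> fst (q k)" for k using strict_mono_imp_increasing by blast
  \<comment> \<open>Between the nodes k and k + 1 the deviation is at most 4 times the scale of node
    k - 1 plus twice that of node k, that is less than 6 e / 8.\<close>
  obtain K where K: "\<And>k. K \<le> k \<Longrightarrow> scale k < e / 8"
    using scale_eventually_less[of "e / 8"] e unfolding eventually_sequentially by auto
  show "\<forall>\<^sub>F m in sequentially. \<exists>i. y \<in> dyadic_box m i \<and> \<bar>dyadic_density A m i - \<alpha>\<bar> < e"
    using eventually_ge_at_top[of "fst (q (Suc K))"]
  proof eventually_elim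
    case (elim m)
    \<comment> \<open>The least such k satisfies fst (q k) \<le> m < fst (q (k + 1)). The threshold
      for m forces k > K, so that node k has a predecessor with index at least K.\<close>
    let ?P = "\<lambda>k. m < fst (q (Suc k))"
    have "?P m" using ge[of "Suc m"] by simp
    define k where "k = (LEAST k. ?P k)"
    have k: "?P k" unfolding k_def by (rule LeastI[of ?P m]) fact
    have "K < k"
    proof (rule ccontr)
      assume "\<not> K < k"
      then have "fst (q (Suc k)) \<le> fst (q (Suc K))" using strict_mono_mono[OF smono] by (simp add: mono_def)
      then show False using k elim by simp
    qed
    then obtain k' where k': "k = Suc k'" "K \<le> k'" by (cases k) auto
    have "\<not> ?P k'" using not_less_Least[of k' ?P] k' by (simp add: k_def)
    then have m: "fst (q k) \<le> m" "m \<le> fst (q (Suc k))" using k k' by auto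
    have "\<bar>dyadic_density A (fst (q k)) (snd (q k)) - \<alpha>\<bar> \<le> 2 * scale (fst (q k'))"
      using ret[of k'] k' by (simp add: return_to_def)
    moreover have "scale (fst (q k')) < e / 8" "scale (fst (q k)) < e / 8"
      using ge[of k] ge[of k'] k' by (intro K; simp)+
    moreover obtain i where i: "dyadic (fst (q (Suc k))) (snd (q (Suc k))) \<subseteq> dyadic m i"
      "\<bar>dyadic_density A m i - \<alpha>\<bar> \<le> 2 * \<bar>dyadic_density A (fst (q k)) (snd (q k)) - \<alpha>\<bar> + 2 * scale (fst (q k))"
      using ret[of k] m unfolding return_to_def by blast
    moreover have "x < e" if "a \<le> 2 * b" "b < e / 8" "c < e / 8" "x \<le> 2 * a + 2 * c" for a b c x
      using that e by linarith
    ultimately have "\<bar>dyadic_density A m i - \<alpha>\<bar> < e" by blast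
    moreover have "y \<in> dyadic_box m i" using y[of "Suc k"] dyadic_box_mono[OF i(1)] by blast
    ultimately show ?case by blast
  qed
qed

text \<open>A bound from below for the s-sums of all countable covers, with c fixed by the size of
  the initial cube. Stated for covers with bounds d i in place of diameters, it can be carried over
  by a Lipschitz map.\<close>

lemma closed_dyadic_limit_not_covered:
  assumes pos: "emeasure lebesgue A > 0" "emeasure lebesgue (- A) > 0" and \<alpha>: "0 < \<alpha>" "\<alpha> < 1"
    and s: "0 < s" "s < real CARD('n)"
  obtains c where "c > 0"
    "\<And>(U :: nat \<Rightarrow> (real ^ 'n) set) d. (\<And>i. d i > 0) \<Longrightarrow> (\<And>i x y. x \<in> U i \<Longrightarrow> y \<in> U i \<Longrightarrow> dist x y \<le> d i) \<Longrightarrow>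
      summable (\<lambda>i. d i powr s) \<Longrightarrow> (\<Sum>i. d i powr s) < c \<Longrightarrow> \<not> closed_dyadic_limit \<alpha> \<subseteq> (\<Union>i. U i)"
proof -
  let ?n = "real CARD('n)"
  \<comment> \<open>Nodes deviate by at most 2 \<gamma> and scales are below \<gamma>, so an
    excursion has length below 3 \<gamma> and stays within 5 \<gamma> of \<alpha>, inside the
    interval from 0 to 1.\<close>
  define \<gamma> where "\<gamma> = min \<alpha> (1 - \<alpha>) / 8"
  have \<gamma>: "0 < \<gamma>" "8 * \<gamma> \<le> \<alpha>" "8 * \<gamma> \<le> 1 - \<alpha>" using \<alpha> by (auto simp: \<gamma>_def)
  have "(1 / 2 :: real) powr (?n - s) < 1"
    using s powr_less_mono2[of "?n - s" "1/2" 1] by simp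
  then have "(\<lambda>N. ((1 / 2 :: real) powr (?n - s)) ^ N) \<longlonglongrightarrow> 0"
    by (intro LIMSEQ_realpow_zero) simp_all
  then have "\<forall>\<^sub>F N in sequentially. ((1 / 2 :: real) powr (?n - s)) ^ N < (1 / 4) ^ Suc CARD('n)"
    by (rule order_tendstoD) simp
  then obtain N where "((1 / 2 :: real) powr (?n - s)) ^ N < (1 / 4) ^ Suc CARD('n)"
    using eventually_happens'[OF sequentially_bot] by blast
  moreover have "((1 / 2 :: real) powr (?n - s)) ^ N = (1 / 2 ^ N) powr (?n - s)"
    by (simp add: powr_realpow[symmetric] powr_powr powr_divide mult.commute)
  ultimately have N: "(1 / 2 ^ N) powr (?n - s) \<le> (1 / 4) ^ Suc CARD('n)" by simp
  have "\<forall>\<^sub>F k in sequentially. scale k < \<gamma> \<and> scale k < 1 / (real N + 1)"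
    using \<gamma> by (intro eventually_conj scale_eventually_less) auto
  then obtain K where K: "\<And>k. K \<le> k \<Longrightarrow> scale k < \<gamma> \<and> scale k < 1 / (real N + 1)"
    unfolding eventually_sequentially by blast
  have K1: "scale k < 1" "scale k * real N \<le> 1" if "K \<le> k" for k
  proof -
    have "scale k * (real N + 1) < 1" using K[OF that] by (simp add: less_divide_eq)
    moreover have "scale k * (real N + 1) = scale k * real N + scale k" by (simp add: algebra_simps)
    moreover have "0 \<le> scale k * real N" using scale_pos[of k] by simp
    ultimately show "scale k < 1" "scale k * real N \<le> 1" using scale_pos[of k] by linarith+
  qed
  have "\<forall>\<^sub>F k in sequentially. K \<le> k \<and> (\<exists>i. \<bar>dyadic_density A k i - \<alpha>\<bar> \<le> \<omega> k)"
    by (intro eventually_conj eventually_ge_at_top density_near_exists[OF pos \<alpha>])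
  then obtain k0 i0 where k0: "K \<le> k0" "\<bar>dyadic_density A k0 i0 - \<alpha>\<bar> \<le> \<omega> k0"
    using eventually_happens'[OF sequentially_bot] by blast
  \<comment> \<open>The tolerance reproduces itself: a child deviates by at most twice the scale of
    its parent, which is below 2 \<gamma>.\<close>
  define P where "P q \<longleftrightarrow> K \<le> fst q \<and> \<bar>dyadic_density A (fst q) (snd q) - \<alpha>\<bar> \<le> 2 * \<gamma>" for q
  have "\<omega> k0 \<le> 3 * ?n * \<omega> k0"
  proof -
    have "1 * \<omega> k0 \<le> 3 * ?n * \<omega> k0"
      using \<omega>_pos[of k0] zero_less_card_finite[where 'a = 'n] by (intro mult_right_mono) linarith+
    then show ?thesis by simp
  qed
  also have "\<dots> = scale k0 * scale k0" by (simp add: scale_square)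
  also have "\<dots> \<le> scale k0"
    using K1(1)[OF k0(1)] scale_pos[of k0] by (simp add: mult_left_le_one_le)
  finally have P0: "P (k0, i0)" using k0 K[OF k0(1)] \<gamma>(1) by (simp add: P_def)
  show thesis
  proof
    show "(1 / 4) ^ Suc CARD('n) * (1 / 2 ^ k0) powr s > 0" by simp
    fix U :: "nat \<Rightarrow> (real ^ 'n) set" and d
    assume d: "\<And>i. d i > 0" "\<And>i x y. x \<in> U i \<Longrightarrow> y \<in> U i \<Longrightarrow> dist x y \<le> d i" "summable (\<lambda>i. d i powr s)"
      "(\<Sum>i. d i powr s) < (1 / 4) ^ Suc CARD('n) * (1 / 2 ^ k0) powr s"
    have step: "\<exists>F. finite F \<and>
       (\<forall>q'\<in>F. \<forall>q''\<in>F. q' \<noteq> q'' \<longrightarrow> dyadic (fst q') (snd q') \<inter> dyadic (fst q'') (snd q'') = {}) \<and>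
       (\<forall>q'\<in>F. P q' \<and> return_to \<alpha> q q' \<and> fst q + N \<le> fst q' \<and> dyadic (fst q') (snd q') \<subseteq> dyadic (fst q) (snd q)) \<and>
       dyadic_vol TYPE('n) (fst q) \<le> 4 * (\<Sum>q'\<in>F. dyadic_vol TYPE('n) (fst q'))" if "P q" for q
    proof -
      obtain k i where q: "q = (k, i)" by (cases q)
      have k: "K \<le> k" and D: "\<bar>dyadic_density A k i - \<alpha>\<bar> \<le> 2 * \<gamma>" using that by (auto simp: P_def q)
      note Kk = K[OF k]
      have "\<bar>dyadic_density A k i - \<alpha>\<bar> + scale k < dyadic_density A k i"
        "dyadic_density A k i + (\<bar>dyadic_density A k i - \<alpha>\<bar> + scale k) < 1"
        using D \<gamma> Kk by (auto simp: abs_le_iff)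
      from return_family[OF _ K1(2)[OF k] this] K1(1)[OF k]
      obtain F where F: "finite F"
        "\<forall>q'\<in>F. \<forall>q''\<in>F. q' \<noteq> q'' \<longrightarrow> dyadic (fst q') (snd q') \<inter> dyadic (fst q'') (snd q'') = {}"
        "\<forall>q'\<in>F. return_to \<alpha> (k, i) q' \<and> k + N \<le> fst q' \<and> dyadic (fst q') (snd q') \<subseteq> dyadic k i"
        "dyadic_vol TYPE('n) k \<le> 4 * (\<Sum>q'\<in>F. dyadic_vol TYPE('n) (fst q'))"
        by (metis less_imp_le)
      have "P q'" if "q' \<in> F" for q'
      proof -
        have "\<bar>dyadic_density A (fst q') (snd q') - \<alpha>\<bar> \<le> 2 * scale k" "k + N \<le> fst q'"
          using F(3) that by (auto simp: return_to_def)
        then show ?thesis using k Kk by (simp add: P_def)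
      qed
      then show ?thesis using F by (intro exI[of _ F]) (simp add: q)
    qed
    show "\<not> closed_dyadic_limit \<alpha> \<subseteq> (\<Union>i. U i)"
    proof (rule dyadic_tree_point_outside_cover[where P = P and R = "return_to \<alpha>", OF s N d(1-3) _ P0 step])
      show "(\<Sum>i. d i powr s) < (1 / 4) ^ Suc CARD('n) * (1 / 2 ^ fst (k0, i0)) powr s" using d(4) by simp
      fix q y
      assume "\<And>k. return_to \<alpha> (q k) (q (Suc k))" "\<And>k. fst (q k) < fst (q (Suc k))"
        "\<And>k. y \<in> dyadic_box (fst (q k)) (snd (q k))" "\<And>i. y \<notin> U i"
      then show ?thesis using return_sequence_limit[of q \<alpha> y] by auto
    qed
  qed
qed

end

subsection \<open>Images of cubes under bilipschitz maps\<close>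

lemma bilipschitzE:
  assumes "bilipschitz f"
  obtains C where "C \<ge> 1" "\<And>x y. dist (f x) (f y) \<le> C * dist x y" "\<And>x y. dist x y \<le> C * dist (f x) (f y)"
proof -
  obtain C where C: "C \<ge> 1" "\<And>x y. inverse C * norm (x - y) \<le> norm (f x - f y)" "\<And>x y. norm (f x - f y) \<le> C * norm (x - y)"
    using assms unfolding bilipschitz_def by blast
  show thesis
  proof
    show "dist x y \<le> C * dist (f x) (f y)" for x y
      using C(1) C(2)[of x y] by (simp add: dist_norm field_simps)
  qed (use C in \<open>simp_all add: dist_norm\<close>)
qed

lemma bilipschitz_surj:
  fixes f :: "'a::euclidean_space \<Rightarrow> 'a"
  assumes "bilipschitz f"
  shows "surj f"
proof -
  obtain C where C: "C \<ge> 1" "\<And>x y. dist (f x) (f y) \<le> C * dist x y" "\<And>x y. dist x y \<le> C * dist (f x) (f y)"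
    using bilipschitzE[OF assms] by blast
  have "C-lipschitz_on UNIV f" using C by (intro lipschitz_onI) auto
  then have cont: "continuous_on UNIV f" by (rule lipschitz_on_continuous_on)
  have inj: "inj f"
    using C(3) by (metis dist_eq_0_iff dist_le_zero_iff injI mult_zero_right)
  have "open (range f)" using invariance_of_domain[OF cont open_UNIV inj] .
  \<comment> \<open>Preimages of a convergent sequence are Cauchy by the lower bilipschitz bound.
    Being open, closed and nonempty, the range is the whole connected space.\<close>
  moreover have "closed (range f)"
    unfolding closed_sequential_limits
  proof (intro allI impI, elim conjE)
    fix z l assume z: "\<forall>k. z k \<in> range f" and l: "z \<longlonglongrightarrow> l"
    define x where "x k = inv f (z k)" for k
    have fx: "f (x k) = z k" for k using z by (simp add: x_def f_inv_into_f)
    have "Cauchy x"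
    proof (rule metric_CauchyI)
      fix e :: real assume "e > 0"
      then have "e / C > 0" using C(1) by simp
      then obtain M where M: "\<And>m k. M \<le> m \<Longrightarrow> M \<le> k \<Longrightarrow> dist (z m) (z k) < e / C"
        using LIMSEQ_imp_Cauchy[OF l] metric_CauchyD by metis
      have "dist (x m) (x k) < e" if "M \<le> m" "M \<le> k" for m k
      proof -
        have "C * dist (z m) (z k) < e"
          using M[OF that] C(1) by (simp add: less_divide_eq mult.commute)
        then show ?thesis using C(3)[of "x m" "x k"] by (simp add: fx)
      qed
      then show "\<exists>M. \<forall>m\<ge>M. \<forall>k\<ge>M. dist (x m) (x k) < e" by blast
    qed
    then obtain a where "x \<longlonglongrightarrow> a" using Cauchy_convergent_iff convergent_def by blast
    then have "(\<lambda>k. f (x k)) \<longlonglongrightarrow> f a"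
      using continuous_on_tendsto_compose[OF cont, of x a] by simp
    then have "z \<longlonglongrightarrow> f a" by (simp add: fx)
    then show "l \<in> range f" using LIMSEQ_unique[OF l] by blast
  qed
  ultimately show ?thesis using clopen[of "range f"] by blast
qed

text \<open>Outer dyadic approximation of S as in Jordan content, with \<open>dyadic_core\<close> as
  the inner one; their difference is the boundary layer.\<close>

definition dyadic_hull :: "nat \<Rightarrow> (real ^ 'n) set \<Rightarrow> (real ^ 'n) set" where
  "dyadic_hull m S = {x. grid_index m x \<in> grid_index m ` S}"

definition dyadic_core :: "nat \<Rightarrow> (real ^ 'n) set \<Rightarrow> (real ^ 'n) set" where
  "dyadic_core m S = {x. dyadic m (grid_index m x) \<subseteq> S}"

lemma dyadic_core_subset: "dyadic_core m S \<subseteq> S"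
  using mem_dyadic_index by (fastforce simp: dyadic_core_def)

lemma subset_dyadic_hull: "S \<subseteq> dyadic_hull m S"
  by (auto simp: dyadic_hull_def)

lemma saturated_dyadic_hull: "saturated m (dyadic_hull m S)"
  and saturated_dyadic_core: "saturated m (dyadic_core m S)"
  unfolding dyadic_hull_def dyadic_core_def by (simp_all add: saturated_def)

lemma grid_index_dyadic_hull: "grid_index m ` dyadic_hull m S = grid_index m ` S"
  by (auto simp: dyadic_hull_def)

lemma component_diff_le_if_grid_index_eq:
  "grid_index m x = grid_index m y \<Longrightarrow> \<bar>x $ j - y $ j\<bar> \<le> 1 / 2 ^ m"
  using dyadic_subset_box[of m "grid_index m x"]
  by (intro dyadic_box_component_diff[of _ _ "grid_index m x"]) (auto simp: dyadic_def)

lemma dyadic_hull_component_near: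
  assumes "x \<in> dyadic_hull m S"
  obtains s where "s \<in> S" "grid_index m s = grid_index m x" "\<And>j. \<bar>x $ j - s $ j\<bar> \<le> 1 / 2 ^ m"
  using assms component_diff_le_if_grid_index_eq unfolding dyadic_hull_def by (metis (mono_tags, lifting) imageE mem_Collect_eq)

lemma bounded_dyadic_hull:
  fixes S :: "(real ^ 'n) set"
  assumes "bounded S"
  shows "bounded (dyadic_hull m S)"
proof -
  obtain B where B: "\<And>s. s \<in> S \<Longrightarrow> norm s \<le> B" using assms bounded_iff by blast
  have "norm x \<le> B + real CARD('n) / 2 ^ m" if x: "x \<in> dyadic_hull m S" for x
  proof -
    obtain s where s: "s \<in> S" "grid_index m s = grid_index m x"
      using dyadic_hull_component_near[OF x] by blast
    then have "dist x s \<le> real CARD('n) / 2 ^ m" by (intro dist_dyadic_le) simp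
    then show ?thesis using B[OF s(1)] norm_triangle_ineq[of s "x - s"] by (simp add: dist_norm)
  qed
  then show ?thesis using bounded_iff by blast
qed

lemma cube_eq: "cube x h = {z. \<forall>j. \<bar>z $ j - x $ j\<bar> \<le> h / 2}"
proof -
  have "a - h / 2 \<le> b \<and> b \<le> a + h / 2 \<longleftrightarrow> \<bar>b - a\<bar> \<le> h / 2" for a b by linarith
  then show ?thesis
    by (intro set_eqI) (simp only: cube_def mem_box_cart mem_Collect_eq vector_minus_component
        vector_add_component vec_component)
qed

lemma measure_cube: "h \<ge> 0 \<Longrightarrow> measure lebesgue (cube x h) = h ^ CARD('n)" for x :: "real ^ 'n"
  unfolding cube_def by (subst measure_lebesgue_cbox_cart) auto

lemma cube_lmeasurable [simp]: "cube x h \<in> lmeasurable"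
  by (simp add: cube_def)

lemma sets_cube [simp]: "cube x h \<in> sets lebesgue"
  by (simp add: cube_def)

text \<open>The part of S in a cube of generation m is mapped into a cube of side 2 C n / 2^m. The
  constant is crude but harmless, since the bound is applied to thin shells. W stands in for the
  image, whose measurability is thereby left aside.\<close>

lemma measure_Lipschitz_image_le:
  fixes f :: "real ^ 'n \<Rightarrow> real ^ 'n"
  assumes C: "C \<ge> 0" "\<And>x y. dist (f x) (f y) \<le> C * dist x y"
    and S: "bounded S" and W: "W \<in> sets lebesgue" "W \<subseteq> f ` S"
  shows "measure lebesgue W \<le> (2 * C * CARD('n)) ^ CARD('n) * measure lebesgue (dyadic_hull m S)"
proof -
  let ?n = "real CARD('n)"
  let ?I = "grid_index m ` S"
  let ?p = "\<lambda>i. SOME p. p \<in> S \<and> grid_index m p = i"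
  let ?Q = "\<lambda>i. cube (f (?p i)) (2 * C * ?n / 2 ^ m)"
  have fin: "finite ?I" by (rule finite_grid_index_image[OF S])
  have WQ: "W \<subseteq> (\<Union>i\<in>?I. ?Q i)"
  proof
    fix w assume "w \<in> W"
    then obtain x where x: "x \<in> S" "w = f x" using W(2) by blast
    let ?i = "grid_index m x"
    have "?p ?i \<in> S \<and> grid_index m (?p ?i) = ?i" by (rule someI[of _ x]) (use x in simp)
    then have "dist x (?p ?i) \<le> ?n / 2 ^ m" by (intro dist_dyadic_le) simp
    then have "C * dist x (?p ?i) \<le> C * (?n / 2 ^ m)" using C(1) by (intro mult_left_mono)
    then have d: "dist w (f (?p ?i)) \<le> C * (?n / 2 ^ m)" using C(2)[of x "?p ?i"] x(2) by simp
    have "\<bar>w $ j - f (?p ?i) $ j\<bar> \<le> (2 * C * ?n / 2 ^ m) / 2" for j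
      using d component_le_norm_cart[of "w - f (?p ?i)" j] by (simp add: dist_norm)
    then have "w \<in> ?Q ?i" by (simp add: cube_eq)
    then show "w \<in> (\<Union>i\<in>?I. ?Q i)" using x(1) by blast
  qed
  have "measure lebesgue W \<le> measure lebesgue (\<Union>i\<in>?I. ?Q i)"
    using WQ W(1) fin by (intro measure_mono_fmeasurable fmeasurable.finite_UN) auto
  also have "\<dots> \<le> (\<Sum>i\<in>?I. measure lebesgue (?Q i))"
    using fin by (intro measure_UNION_le) auto
  also have "\<dots> = card ?I * (2 * C * ?n / 2 ^ m) ^ CARD('n)"
    using C(1) by (simp add: measure_cube)
  also have "(2 * C * ?n / 2 ^ m) ^ CARD('n) = (2 * C * ?n) ^ CARD('n) * dyadic_vol TYPE('n) m"
    by (simp add: dyadic_vol_def power_divide)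
  also have "card ?I * ((2 * C * ?n) ^ CARD('n) * dyadic_vol TYPE('n) m) = (2 * C * ?n) ^ CARD('n) * measure lebesgue (dyadic_hull m S)"
    using measure_saturated[OF saturated_dyadic_hull bounded_dyadic_hull[OF S], of m] by (simp add: grid_index_dyadic_hull)
  finally show ?thesis .
qed

text \<open>Pull back: a cube of generation m meeting both the image and its complement has a
  preimage of diameter at most \<tau>, so the boundary layer is the image of points within \<tau> of
  the boundary of the cube. Surjectivity provides the preimages.\<close>

lemma measure_image_cube_boundary_le:
  fixes f :: "real ^ 'n \<Rightarrow> real ^ 'n"
  assumes C: "C \<ge> 1" "\<And>x y. dist (f x) (f y) \<le> C * dist x y" "\<And>x y. dist x y \<le> C * dist (f x) (f y)" "surj f"
    and h: "4 * C * CARD('n) / 2 ^ m \<le> h"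
  shows "measure lebesgue (dyadic_hull m (f ` cube x h) - dyadic_core m (f ` cube x h))
    \<le> (2 * C * CARD('n)) ^ CARD('n) *
      ((h + 4 * C * CARD('n) / 2 ^ m) ^ CARD('n) - (h - 4 * C * CARD('n) / 2 ^ m) ^ CARD('n))"
proof -
  let ?n = "real CARD('n)"
  let ?S = "f ` cube x h"
  define \<tau> where "\<tau> = C * ?n / 2 ^ m"
  define r where "r = 1 / (2::real) ^ m"
  have n1: "1 \<le> ?n" using zero_less_card_finite[where 'a = 'n] by linarith
  have "1 * 1 \<le> C * ?n" using C(1) n1 by (intro mult_mono) auto
  then have r\<tau>: "r \<le> \<tau>" unfolding r_def \<tau>_def by (intro divide_right_mono) auto
  have r0: "r > 0" by (simp add: r_def)
  have h4: "4 * \<tau> \<le> h" using h by (simp add: \<tau>_def)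
  define T where "T = {u. (\<forall>j. \<bar>u $ j - x $ j\<bar> \<le> h / 2 + \<tau>) \<and> (\<exists>j. h / 2 - \<tau> < \<bar>u $ j - x $ j\<bar>)}"
  have near: "\<bar>u $ j - u' $ j\<bar> \<le> \<tau>" if "grid_index m (f u) = grid_index m (f u')" for u u' j
  proof -
    have "dist u u' \<le> C * dist (f u) (f u')" by (rule C)
    also have "\<dots> \<le> C * (?n / 2 ^ m)" using C(1) dist_dyadic_le[OF that] by (intro mult_left_mono) auto
    finally show ?thesis using component_le_norm_cart[of "u - u'" j] by (simp add: dist_norm \<tau>_def)
  qed
  have bS: "bounded ?S"
  proof -
    have "C-lipschitz_on UNIV f" using C by (intro lipschitz_onI) auto
    then have "continuous_on (cube x h) f" using lipschitz_on_continuous_on continuous_on_subset by blast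
    then have "compact ?S" by (intro compact_continuous_image) (simp_all add: cube_def)
    then show ?thesis by (rule compact_imp_bounded)
  qed
  have sub: "dyadic_hull m ?S - dyadic_core m ?S \<subseteq> f ` T"
  proof
    fix z assume z: "z \<in> dyadic_hull m ?S - dyadic_core m ?S"
    obtain u where u: "z = f u" using C(4) by (metis surjD)
    obtain a where a: "a \<in> cube x h" "grid_index m (f a) = grid_index m (f u)"
      using z u by (auto simp: dyadic_hull_def)
    obtain w where w: "grid_index m w = grid_index m (f u)" "w \<notin> ?S"
      using z u by (auto simp: dyadic_core_def dyadic_def)
    obtain b where b: "w = f b" using C(4) by (metis surjD)
    have bQ: "b \<notin> cube x h" using w b by blast
    have "\<bar>u $ j - x $ j\<bar> \<le> h / 2 + \<tau>" for j
    proof -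
      have "\<bar>a $ j - x $ j\<bar> \<le> h / 2" using a(1) by (simp add: cube_eq)
      then show ?thesis using near[OF a(2), of j] by linarith
    qed
    moreover obtain j where j: "h / 2 < \<bar>b $ j - x $ j\<bar>" using bQ by (force simp: cube_eq not_le)
    have "h / 2 - \<tau> < \<bar>u $ j - x $ j\<bar>"
    proof -
      have "\<bar>b $ j - u $ j\<bar> \<le> \<tau>" using near[of b u j] w(1) b by simp
      then show ?thesis using j by linarith
    qed
    ultimately show "z \<in> f ` T" unfolding u T_def by blast
  qed
  have T: "T \<subseteq> cube x (h + 2 * \<tau>)" by (auto simp: T_def cube_eq add_divide_distrib)
  have bT: "bounded T" by (rule bounded_subset[OF _ T]) (simp add: cube_def)
  have "measure lebesgue (dyadic_hull m ?S - dyadic_core m ?S) \<le> (2 * C * ?n) ^ CARD('n) * measure lebesgue (dyadic_hull m T)"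
  proof (rule measure_Lipschitz_image_le[OF _ C(2) bT _ sub])
    have "dyadic_core m ?S \<in> lmeasurable"
      using saturated_lmeasurable[OF saturated_dyadic_core bounded_subset[OF bS dyadic_core_subset]] .
    then show "dyadic_hull m ?S - dyadic_core m ?S \<in> sets lebesgue"
      using saturated_lmeasurable[OF saturated_dyadic_hull bounded_dyadic_hull[OF bS]] by auto
  qed (use C in simp)
  also have "measure lebesgue (dyadic_hull m T) \<le> measure lebesgue (cube x (h + 4 * \<tau>) - cube x (h - 4 * \<tau>))"
  proof (rule measure_mono_fmeasurable)
    \<comment> \<open>Each face moves by \<tau> for the shell and by r \<le> \<tau> for its hull,
      which changes the side length by 4 \<tau>.\<close>
    show "dyadic_hull m T \<subseteq> cube x (h + 4 * \<tau>) - cube x (h - 4 * \<tau>)"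
    proof
      fix v assume "v \<in> dyadic_hull m T"
      then obtain u where u: "u \<in> T" "\<And>j. \<bar>v $ j - u $ j\<bar> \<le> r"
        by (rule dyadic_hull_component_near[of v m T, folded r_def]) (rule that)
      obtain j where j: "h / 2 - \<tau> < \<bar>u $ j - x $ j\<bar>" using u(1) by (auto simp: T_def)
      have far: "h / 2 - 2 * \<tau> < \<bar>v $ j - x $ j\<bar>" using j u(2)[of j] r\<tau> by linarith
      have "v \<notin> cube x (h - 4 * \<tau>)"
      proof
        assume "v \<in> cube x (h - 4 * \<tau>)"
        then have "\<bar>v $ j - x $ j\<bar> \<le> (h - 4 * \<tau>) / 2" unfolding cube_eq by blast
        then show False using far by (simp add: diff_divide_distrib)
      qed
      moreover have "\<bar>v $ j - x $ j\<bar> \<le> (h + 4 * \<tau>) / 2" for j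
      proof -
        have "\<bar>u $ j - x $ j\<bar> \<le> h / 2 + \<tau>" using u(1) by (simp add: T_def)
        then show ?thesis
          using u(2)[of j] r\<tau> abs_triangle_ineq[of "v $ j - u $ j" "u $ j - x $ j"] by (simp add: add_divide_distrib)
      qed
      ultimately show "v \<in> cube x (h + 4 * \<tau>) - cube x (h - 4 * \<tau>)" by (simp add: cube_eq)
    qed
    show "dyadic_hull m T \<in> sets lebesgue"
      using saturated_lmeasurable[OF saturated_dyadic_hull bounded_dyadic_hull[OF bT]] by auto
    show "cube x (h + 4 * \<tau>) - cube x (h - 4 * \<tau>) \<in> lmeasurable"
      by (intro fmeasurable_Diff) auto
  qed
  also have "\<dots> = (h + 4 * \<tau>) ^ CARD('n) - (h - 4 * \<tau>) ^ CARD('n)"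
  proof -
    have "cube x (h - 4 * \<tau>) \<subseteq> cube x (h + 4 * \<tau>)"
      using r0 r\<tau> unfolding cube_eq by (smt (verit, ccfv_SIG) Collect_mono divide_right_mono)
    then show ?thesis
      using h4 r0 r\<tau> by (subst measurable_measure_Diff) (auto simp: measure_cube)
  qed
  finally show ?thesis using C(1) by (simp add: \<tau>_def mult_left_mono mult.assoc)
qed

lemma smooth_set_dyadic_smooth:
  fixes A :: "(real ^ 'n) set"
  assumes "smooth_set A"
  obtains \<omega> where "dyadic_smooth A \<omega>"
proof -
  have A: "A \<in> sets lebesgue" using assms by (simp add: smooth_set_def)
  let ?g = "\<lambda>k (i, j). dyadic_density A k (i + axis j 1) - dyadic_density A k i"
  have "\<bar>?g k p\<bar> \<le> 1" for k p
  proof -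
    obtain i j where p: "p = (i, j)" by (cases p)
    show ?thesis
      using dyadic_density_bounds[OF A, of k i] dyadic_density_bounds[OF A, of k "i + axis j 1"]
      by (auto simp: p)
  qed
  moreover have "\<forall>\<^sub>F k in sequentially. \<forall>p. \<bar>?g k p\<bar> < e" if "e > 0" for e
    using smooth_set_dyadic_density_diff[OF assms that] by simp
  ultimately obtain \<omega> where \<omega>: "\<And>k. \<omega> k > 0" "\<And>k l. k \<le> l \<Longrightarrow> \<omega> l \<le> \<omega> k" "\<omega> \<longlonglongrightarrow> 0" "\<And>k p. \<bar>?g k p\<bar> \<le> \<omega> k"
    using antimono_modulus_exists[of ?g 1] by blast
  have "dyadic_smooth A \<omega>"
  proof
    show "\<bar>dyadic_density A k (i + axis j 1) - dyadic_density A k i\<bar> \<le> \<omega> k" for k i j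
      using \<omega>(4)[of k "(i, j)"] by simp
  qed (use A \<omega> in auto)
  then show thesis by (rule that)
qed

section \<open>Densities of a smooth set in images of cubes\<close>

context dyadic_smooth
begin

text \<open>
  On scale \<open>2\<^sup>-\<^sup>m\<close> all dyadic cubes near \<open>y\<close> have nearly the density of \<open>dyadic k i\<close>, hence so has every
  set that is well approximated by unions of such cubes.
\<close>

lemma measure_Int_density_diff_le:
  assumes S: "S \<in> lmeasurable" "bounded S" and km: "k \<le> m"
    and y: "y \<in> dyadic_box k i" "\<And>z j. z \<in> S \<Longrightarrow> \<bar>z $ j - y $ j\<bar> \<le> \<rho>" and \<rho>: "1 / 2 ^ k \<le> \<rho>"
    and L: "measure lebesgue (dyadic_hull m S - dyadic_core m S) \<le> L"
  defines "err \<equiv> \<omega> m * (real CARD('n) * (2 ^ m * (3 * \<rho>) + 1))"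
  shows "\<bar>measure lebesgue (A \<inter> S) - dyadic_density A k i * measure lebesgue S\<bar> \<le> err * (measure lebesgue S + L) + L"
proof -
  let ?D = "dyadic_density A k i"
  let ?H = "dyadic_hull m S" and ?I = "dyadic_core m S"
  have bdd: "bounded ?H" "bounded ?I"
    by (rule bounded_dyadic_hull[OF S(2)]) (rule bounded_subset[OF S(2) dyadic_core_subset])
  have H: "?H \<in> lmeasurable" and I: "?I \<in> lmeasurable"
    by (rule saturated_lmeasurable[OF saturated_dyadic_hull bdd(1)])
      (rule saturated_lmeasurable[OF saturated_dyadic_core bdd(2)])
  have D: "0 \<le> ?D" "?D \<le> 1" using dyadic_density_bounds[OF A] by auto
  have \<rho>0: "\<rho> > 0" using \<rho> by (smt (verit) zero_less_divide_1_iff zero_less_power)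
  have err0: "0 \<le> err" using \<omega>_pos[of m] \<rho>0 by (simp add: err_def)
  have "1 / 2 ^ m \<le> (1 / 2 ^ k :: real)" using km by (intro divide_left_mono power_increasing) auto
  with \<rho> have m\<rho>: "1 / 2 ^ m \<le> \<rho>" by linarith
  have fine: "\<bar>?D - dyadic_density A m (grid_index m x)\<bar> \<le> err" if x: "x \<in> ?H" for x
    unfolding err_def
  proof (rule density_coarse_fine_diff_le[OF km])
    fix z j assume z: "z \<in> dyadic k i"
    obtain s where s: "s \<in> S" "\<And>j. \<bar>x $ j - s $ j\<bar> \<le> 1 / 2 ^ m"
      using dyadic_hull_component_near[OF x] by blast
    have "\<bar>z $ j - y $ j\<bar> \<le> 1 / 2 ^ k"
      using z y(1) dyadic_subset_box[of k i] by (intro dyadic_box_component_diff) auto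
    \<comment> \<open>One \<rho> each from z to y, from y to a point of S, and from there to
      x.\<close>
    then show "\<bar>z $ j - x $ j\<bar> \<le> 3 * \<rho>"
      using s(2)[of j] y(2)[OF s(1), of j] \<rho> m\<rho> by linarith
  qed
  have IS: "measure lebesgue ?I \<le> measure lebesgue S"
    using S I dyadic_core_subset by (intro measure_mono_fmeasurable) auto
  have HI: "measure lebesgue ?H = measure lebesgue ?I + measure lebesgue (?H - ?I)"
    using H I dyadic_core_subset[of m S] subset_dyadic_hull[of S m]
    by (subst measurable_measure_Diff) auto
  have SH: "measure lebesgue S \<le> measure lebesgue ?H"
    using S H subset_dyadic_hull by (intro measure_mono_fmeasurable) auto
  have L0: "L \<ge> 0" using L measure_nonneg order_trans by blast
  have "measure lebesgue (A \<inter> S) \<le> measure lebesgue (A \<inter> ?H)"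
    using A S H subset_dyadic_hull by (intro measure_mono_fmeasurable fmeasurable_Int_sets) auto
  also have "\<dots> \<le> (?D + err) * measure lebesgue ?H"
    using fine by (intro measure_Int_saturated_le[OF saturated_dyadic_hull bdd(1) A]) (force simp: abs_le_iff)
  also have "\<dots> \<le> (?D + err) * (measure lebesgue S + L)"
    using D err0 HI IS L by (intro mult_left_mono) auto
  also have "\<dots> \<le> ?D * measure lebesgue S + (err * (measure lebesgue S + L) + L)"
    using mult_right_mono[OF D(2) L0] by (simp add: algebra_simps)
  finally have up: "measure lebesgue (A \<inter> S) \<le> \<dots>" .
  have "?D * (measure lebesgue S - L) \<le> ?D * measure lebesgue ?I"
    using D SH HI L by (intro mult_left_mono) auto
  moreover have "?D * L \<le> L" using mult_right_mono[OF D(2) L0] by simp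
  moreover have "err * measure lebesgue ?I \<le> err * (measure lebesgue S + L)"
    using IS L0 err0 by (intro mult_left_mono) auto
  ultimately have "?D * measure lebesgue S - (err * (measure lebesgue S + L) + L) \<le> (?D - err) * measure lebesgue ?I"
    by (simp add: algebra_simps)
  also have "\<dots> \<le> measure lebesgue (A \<inter> ?I)"
  proof (rule measure_Int_saturated_ge[OF saturated_dyadic_core bdd(2) A])
    fix x assume "x \<in> ?I"
    then have "x \<in> ?H" using dyadic_core_subset[of m S] subset_dyadic_hull[of S m] by blast
    then show "?D - err \<le> dyadic_density A m (grid_index m x)" using fine[of x] by (simp add: abs_le_iff)
  qed
  also have "\<dots> \<le> measure lebesgue (A \<inter> S)"
    using A S I dyadic_core_subset[of m S] by (intro measure_mono_fmeasurable fmeasurable_Int_sets) auto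
  finally show ?thesis using up by (simp add: abs_le_iff)
qed

text \<open>Two errors compete: a finer grid thins the boundary layer but multiplies \<omega> by the
  number of cubes across the image, about 2^p for a grid p generations finer than the cube. So p is
  fixed first, by the layer, and then k is taken large. The bound is uniform in x and in every
  dyadic cube whose closure contains f x.\<close>

lemma density_image_cube_near_dyadic:
  fixes f :: "real ^ 'n \<Rightarrow> real ^ 'n"
  assumes C: "C \<ge> 1" "\<And>x y. dist (f x) (f y) \<le> C * dist x y" "\<And>x y. dist x y \<le> C * dist (f x) (f y)" "surj f"
    and e: "e > 0"
  shows "\<forall>\<^sub>F k in sequentially. \<forall>x h i. 1 / 2 ^ Suc k < h \<longrightarrow> h \<le> 1 / 2 ^ k \<longrightarrow> f x \<in> dyadic_box k i \<longrightarrow>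
    \<bar>measure lebesgue (A \<inter> f ` cube x h) / measure lebesgue (f ` cube x h) - dyadic_density A k i\<bar> < e"
proof -
  let ?n = "real CARD('n)" and ?N = "CARD('n)"
  have n1: "1 \<le> ?n" using zero_less_card_finite[where 'a = 'n] by linarith
  have Cn: "1 * 1 \<le> C * ?n" using C(1) n1 by (intro mult_mono) auto
  \<comment> \<open>As h > 2^-(k+1), the width 4 C n / 2^(k+p) is at most \<theta> p * h; hence 8
    instead of 4. \<open>lam p\<close> bounds the layer relative to the image, its factor (C n)^n
    converting h^n into the lower bound (h / (C n))^n for the volume of the image.\<close>
  define \<theta> where "\<theta> p = 8 * C * ?n / 2 ^ p" for p :: nat
  define lam where "lam p = (2 * C * ?n) ^ ?N * (C * ?n) ^ ?N * ((1 + \<theta> p) ^ ?N - (1 - \<theta> p) ^ ?N)" for p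
  have \<theta>_lim: "\<theta> \<longlonglongrightarrow> 0"
  proof -
    have "(\<lambda>p. 8 * C * ?n * inverse (2 ^ p)) \<longlonglongrightarrow> 8 * C * ?n * 0"
      by (intro tendsto_mult_left LIMSEQ_inverse_realpow_zero) auto
    then show ?thesis by (simp add: \<theta>_def[abs_def] divide_inverse)
  qed
  have "lam \<longlonglongrightarrow> (2 * C * ?n) ^ ?N * (C * ?n) ^ ?N * ((1 + 0) ^ ?N - (1 - 0) ^ ?N)"
    unfolding lam_def by (intro tendsto_intros \<theta>_lim)
  then have "lam \<longlonglongrightarrow> 0" by simp
  then have "\<forall>\<^sub>F p in sequentially. \<theta> p < 1 \<and> lam p < min 1 (e / 4)"
    using e by (intro eventually_conj order_tendstoD(2)[OF \<theta>_lim] order_tendstoD(2)[OF \<open>lam \<longlonglongrightarrow> 0\<close>]) auto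
  then obtain p where p: "\<theta> p < 1" "lam p < 1" "lam p < e / 4"
    using eventually_happens'[OF sequentially_bot] by force
  \<comment> \<open>The index distance across the image, independent of k because the radius C n /
    2^k is 2^p C n sides of generation k + p. The total error is then below 2 (e / 4) + e /
    4.\<close>
  define E where "E = ?n * (2 ^ p * (3 * (C * ?n)) + 1)"
  have E0: "E > 0" using n1 C(1) by (auto simp: E_def intro!: mult_pos_pos add_nonneg_pos)
  have "\<forall>\<^sub>F k in sequentially. \<omega> k < e / (4 * E)"
    using \<omega>_lim e E0 by (auto elim: order_tendstoD)
  then show ?thesis
  proof eventually_elim
    case (elim k)
    show ?case
    proof (intro allI impI)
      fix x :: "real ^ 'n" and h :: real and i :: "int ^ 'n"
      assume h: "1 / 2 ^ Suc k < h" "h \<le> 1 / 2 ^ k" and y: "f x \<in> dyadic_box k i"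
      let ?S = "f ` cube x h"
      define m where "m = k + p"
      have h0: "h > 0" using h(1) by (smt (verit) zero_less_divide_1_iff zero_less_power)
      have cont: "continuous_on (cube x h) f"
      proof -
        have "C-lipschitz_on UNIV f" using C by (intro lipschitz_onI) auto
        then show ?thesis using lipschitz_on_continuous_on continuous_on_subset by blast
      qed
      have "compact ?S" using cont by (intro compact_continuous_image) (simp_all add: cube_def)
      then have S: "?S \<in> lmeasurable" "bounded ?S" by (rule lmeasurable_compact, rule compact_imp_bounded)
      \<comment> \<open>The inverse is C-Lipschitz, so the image contains the ball of radius h / (2
        C) about f x; the further factor n passes from the maximum norm to the Euclidean
        one.\<close>
      have lower: "(h / (C * ?n)) ^ ?N \<le> measure lebesgue ?S"
      proof -
        have "cube (f x) (h / (C * ?n)) \<subseteq> ?S"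
        proof
          fix w assume w: "w \<in> cube (f x) (h / (C * ?n))"
          obtain u where u: "w = f u" using C(4) by (metis surjD)
          have "norm (f u - f x) \<le> ?n * (h / (C * ?n) / 2)"
            using w by (intro norm_le_CARD_mult) (simp add: u cube_eq)
          also have "\<dots> = h / C / 2" using n1 by simp
          finally have "C * dist (f u) (f x) \<le> C * (h / C / 2)"
            using C(1) by (intro mult_left_mono) (auto simp: dist_norm)
          then have "dist u x \<le> h / 2" using C(1) C(3)[of u x] by simp
          then have "\<bar>u $ j - x $ j\<bar> \<le> h / 2" for j
            using component_le_norm_cart[of "u - x" j] by (simp add: dist_norm)
          then show "w \<in> ?S" unfolding u cube_eq by blast
        qed
        then have "measure lebesgue (cube (f x) (h / (C * ?n))) \<le> measure lebesgue ?S"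
          using S by (intro measure_mono_fmeasurable) auto
        then show ?thesis using h0 C(1) by (simp add: measure_cube)
      qed
      have Spos: "measure lebesgue ?S > 0"
        using lower h0 C(1) n1 by (smt (verit, best) divide_pos_pos mult_pos_pos zero_less_power)
      have \<theta>h: "4 * C * ?n / 2 ^ m \<le> \<theta> p * h"
      proof -
        have "4 * C * ?n / 2 ^ m = \<theta> p * (1 / 2 ^ Suc k)" by (simp add: \<theta>_def m_def power_add)
        also have "\<dots> \<le> \<theta> p * h" using h(1) C(1) by (intro mult_left_mono) (auto simp: \<theta>_def)
        finally show ?thesis .
      qed
      define L where "L = lam p * measure lebesgue ?S"
      have \<theta>0: "0 \<le> \<theta> p" using C(1) by (simp add: \<theta>_def)
      have lam0: "0 \<le> lam p"
        unfolding lam_def using C(1) \<theta>0 p(1)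
        by (intro mult_nonneg_nonneg zero_le_power) (auto intro!: power_mono)
      have "\<theta> p * h \<le> 1 * h" using p(1) h0 by (intro mult_right_mono) auto
      with \<theta>h have small: "4 * C * ?n / 2 ^ m \<le> h" by linarith
      have "measure lebesgue (dyadic_hull m ?S - dyadic_core m ?S) \<le> (2 * C * ?n) ^ ?N *
          ((h + 4 * C * ?n / 2 ^ m) ^ ?N - (h - 4 * C * ?n / 2 ^ m) ^ ?N)"
        by (rule measure_image_cube_boundary_le[OF C small])
      also have "\<dots> \<le> (2 * C * ?n) ^ ?N * ((h + \<theta> p * h) ^ ?N - (h - \<theta> p * h) ^ ?N)"
        using C(1) \<theta>h h0 \<open>\<theta> p * h \<le> 1 * h\<close> small
        by (intro mult_left_mono diff_mono power_mono) auto
      also have "\<dots> = lam p * (h / (C * ?n)) ^ ?N"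
      proof -
        have "h + \<theta> p * h = h * (1 + \<theta> p)" "h - \<theta> p * h = h * (1 - \<theta> p)" by (simp_all add: algebra_simps)
        then have eq: "(h + \<theta> p * h) ^ ?N = h ^ ?N * (1 + \<theta> p) ^ ?N" "(h - \<theta> p * h) ^ ?N = h ^ ?N * (1 - \<theta> p) ^ ?N"
          by (simp_all only: power_mult_distrib)
        have hN: "h ^ ?N = (C * ?n) ^ ?N * (h / (C * ?n)) ^ ?N"
          using C(1) by (simp add: power_mult_distrib[symmetric])
        have "a * (b * q * u - b * q * v) = a * b * (u - v) * q" for a b q u v :: real
          by (simp add: algebra_simps)
        then show ?thesis unfolding eq lam_def hN .
      qed
      also have "\<dots> \<le> L" unfolding L_def using lower lam0 by (intro mult_left_mono)
      finally have L: "measure lebesgue (dyadic_hull m ?S - dyadic_core m ?S) \<le> L" .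
      have near: "\<bar>z $ j - f x $ j\<bar> \<le> C * ?n / 2 ^ k" if z: "z \<in> ?S" for z j
      proof -
        obtain u where u: "z = f u" "u \<in> cube x h" using z by blast
        have "norm (u - x) \<le> ?n * (h / 2)"
          using u(2) by (intro norm_le_CARD_mult) (simp add: cube_eq)
        also have "\<dots> \<le> ?n * (1 / 2 ^ k)" using h h0 by (intro mult_left_mono) auto
        finally have "C * dist u x \<le> C * (?n * (1 / 2 ^ k))"
          using C(1) by (intro mult_left_mono) (auto simp: dist_norm)
        then have "dist z (f x) \<le> C * ?n / 2 ^ k" using C(2)[of u x] u(1) by simp
        then show ?thesis using component_le_norm_cart[of "z - f x" j] by (simp add: dist_norm)
      qed
      have \<rho>: "1 / 2 ^ k \<le> C * ?n / 2 ^ k" using Cn by (intro divide_right_mono) auto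
      have "\<bar>measure lebesgue (A \<inter> ?S) - dyadic_density A k i * measure lebesgue ?S\<bar>
          \<le> \<omega> m * (?n * (2 ^ m * (3 * (C * ?n / 2 ^ k)) + 1)) * (measure lebesgue ?S + L) + L"
        by (rule measure_Int_density_diff_le[OF S _ y near \<rho> L]) (auto simp: m_def)
      also have "?n * (2 ^ m * (3 * (C * ?n / 2 ^ k)) + 1) = E"
        by (simp add: E_def m_def power_add field_simps)
      also have "\<omega> m * E * (measure lebesgue ?S + L) + L = (\<omega> m * E * (1 + lam p) + lam p) * measure lebesgue ?S"
        by (simp add: L_def algebra_simps)
      finally have le: "\<bar>measure lebesgue (A \<inter> ?S) - dyadic_density A k i * measure lebesgue ?S\<bar>
          \<le> (\<omega> m * E * (1 + lam p) + lam p) * measure lebesgue ?S" .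
      have "\<omega> m * E < e / 4"
      proof -
        have "\<omega> m * E \<le> \<omega> k * E" using \<omega>_antimono[of k m] E0 by (intro mult_right_mono) (auto simp: m_def)
        also have "\<omega> k * E < e / 4" using elim E0 by (simp add: less_divide_eq mult_ac)
        finally show ?thesis .
      qed
      moreover have "\<omega> m * E * (1 + lam p) \<le> \<omega> m * E * 2"
        using \<omega>_pos[of m] E0 p(2) by (intro mult_left_mono) auto
      ultimately have "\<omega> m * E * (1 + lam p) + lam p < e" using p(3) e by linarith
      then have "(\<omega> m * E * (1 + lam p) + lam p) * measure lebesgue ?S < e * measure lebesgue ?S"
        using Spos by (rule mult_strict_right_mono)
      with le have "\<bar>measure lebesgue (A \<inter> ?S) - dyadic_density A k i * measure lebesgue ?S\<bar> < e * measure lebesgue ?S"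
        by linarith
      moreover have "measure lebesgue (A \<inter> ?S) / measure lebesgue ?S - dyadic_density A k i =
          (measure lebesgue (A \<inter> ?S) - dyadic_density A k i * measure lebesgue ?S) / measure lebesgue ?S"
        using Spos by (simp add: field_simps)
      ultimately show "\<bar>measure lebesgue (A \<inter> ?S) / measure lebesgue ?S - dyadic_density A k i\<bar> < e"
        using Spos by (simp add: divide_less_eq)
    qed
  qed
qed

end

lemma dyadic_scale_exists:
  fixes h :: real
  assumes "0 < h" "h < 1 / 2 ^ K"
  obtains k where "K \<le> k" "1 / 2 ^ Suc k < h" "h \<le> 1 / 2 ^ k"
proof -
  let ?P = "\<lambda>k. 1 / 2 ^ Suc k < h"
  obtain k0 :: nat where "1 / 2 ^ k0 < h"
    using eventually_happens'[OF sequentially_bot eventually_divide_power2_less[OF assms(1), of 1]] by blast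
  moreover have "1 / 2 ^ Suc k0 \<le> (1 / 2 ^ k0 :: real)" by (intro divide_left_mono power_increasing) auto
  ultimately have "?P k0" by linarith
  define k where "k = (LEAST k. ?P k)"
  have k: "?P k" unfolding k_def by (rule LeastI[of ?P]) fact
  have "h \<le> 1 / 2 ^ k"
  proof (cases k)
    case 0
    have "h < 1" using assms(2) by (rule less_le_trans) simp
    then show ?thesis using 0 by simp
  next
    case (Suc l)
    then have "\<not> ?P l" using not_less_Least[of l ?P] by (simp add: k_def)
    then show ?thesis using Suc by simp
  qed
  moreover have "K \<le> k"
  proof (rule ccontr)
    assume "\<not> K \<le> k"
    then have "Suc k \<le> K" by simp
    then have "1 / 2 ^ K \<le> (1 / 2 ^ Suc k :: real)" by (intro divide_left_mono power_increasing) auto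
    then show False using k assms(2) by linarith
  qed
  ultimately show thesis using that k by blast
qed

subsection \<open>The level sets of the density\<close>

theorem corollary1:
  fixes A :: "(real ^ 'n) set"
    and \<phi> :: "real ^ 'n \<Rightarrow> real ^ 'n"
    and \<alpha> :: real
  assumes "smooth_set A"
    and "emeasure lebesgue A > 0"
    and "emeasure lebesgue (UNIV - A) > 0"
    and "bilipschitz \<phi>"
    and "C1_map \<phi>"
    and "uniformly_continuous_on UNIV (\<lambda>x. jacobian \<phi> (at x))"
    and "0 < \<alpha>" and "\<alpha> < 1"
  shows "hausdorff_dim
           {x. ((\<lambda>h. measure lebesgue (A \<inter> \<phi> ` cube x h) / measure lebesgue (\<phi> ` cube x h))
                  \<longlongrightarrow> \<alpha>) (at_right 0)} = of_nat CARD('n)"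
    (is "hausdorff_dim ?E = _")
proof (rule antisym[OF hausdorff_dim_le_CARD])
  let ?n = "real CARD('n)"
  obtain \<omega> where "dyadic_smooth A \<omega>"
    using smooth_set_dyadic_smooth[OF assms(1)] .
  then interpret dyadic_smooth A \<omega> .
  obtain C where C: "C \<ge> 1" "\<And>x y. dist (\<phi> x) (\<phi> y) \<le> C * dist x y" "\<And>x y. dist x y \<le> C * dist (\<phi> x) (\<phi> y)"
    using bilipschitzE[OF assms(4)] by blast
  note surj = bilipschitz_surj[OF assms(4)]
  \<comment> \<open>The cube i provided by \<open>closed_dyadic_limit\<close> may be any neighbour
    whose closure contains \<phi> x; the comparison with the image holds for all of these.\<close>
  have E: "x \<in> ?E" if x: "\<phi> x \<in> closed_dyadic_limit \<alpha>" for x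
  proof (rule CollectI, rule tendstoI)
    fix e :: real assume "e > 0"
    then have e2: "e / 2 > 0" by simp
    have "\<forall>\<^sub>F k in sequentially. \<exists>i. \<phi> x \<in> dyadic_box k i \<and> \<bar>dyadic_density A k i - \<alpha>\<bar> < e / 2"
      using x e2 unfolding closed_dyadic_limit_def by blast
    then obtain K1 where K1: "\<And>k. K1 \<le> k \<Longrightarrow> \<exists>i. \<phi> x \<in> dyadic_box k i \<and> \<bar>dyadic_density A k i - \<alpha>\<bar> < e / 2"
      unfolding eventually_sequentially by blast
    obtain K2 where K2: "\<And>k h i. K2 \<le> k \<Longrightarrow> 1 / 2 ^ Suc k < h \<Longrightarrow> h \<le> 1 / 2 ^ k \<Longrightarrow> \<phi> x \<in> dyadic_box k i \<Longrightarrow>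
        \<bar>measure lebesgue (A \<inter> \<phi> ` cube x h) / measure lebesgue (\<phi> ` cube x h) - dyadic_density A k i\<bar> < e / 2"
      using density_image_cube_near_dyadic[OF C surj e2] unfolding eventually_sequentially by blast
    show "\<forall>\<^sub>F h in at_right 0. dist (measure lebesgue (A \<inter> \<phi> ` cube x h) / measure lebesgue (\<phi> ` cube x h)) \<alpha> < e"
      unfolding eventually_at_right_field
    proof (intro exI[of _ "1 / 2 ^ max K1 K2"] conjI allI impI)
      fix h :: real assume h: "0 < h" "h < 1 / 2 ^ max K1 K2"
      obtain k where k: "max K1 K2 \<le> k" "1 / 2 ^ Suc k < h" "h \<le> 1 / 2 ^ k"
        using dyadic_scale_exists[OF h] .
      obtain i where i: "\<phi> x \<in> dyadic_box k i" "\<bar>dyadic_density A k i - \<alpha>\<bar> < e / 2"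
        using K1[of k] k(1) by auto
      show "dist (measure lebesgue (A \<inter> \<phi> ` cube x h) / measure lebesgue (\<phi> ` cube x h)) \<alpha> < e"
        using K2[OF _ k(2,3) i(1)] k(1) i(2) unfolding dist_real_def by linarith
    qed simp
  qed
  show "of_nat CARD('n) \<le> hausdorff_dim ?E"
    unfolding hausdorff_dim_def
  proof (rule Inf_greatest)
    fix b assume "b \<in> {ennreal s |s. 0 \<le> s \<and> hausdorff_measure s ?E = 0}"
    then obtain s where s: "b = ennreal s" "0 \<le> s" "hausdorff_measure s ?E = 0" by blast
    have "?n \<le> s"
    proof (rule ccontr)
      assume "\<not> ?n \<le> s"
      \<comment> \<open>Lies strictly between 0 and n even if s = 0, as the tree argument
        requires.\<close>
      define s' where "s' = max s (?n / 2)"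
      have s': "s \<le> s'" "0 < s'" "s' < ?n" using \<open>\<not> ?n \<le> s\<close> s(2) by (auto simp: s'_def)
      have pos: "emeasure lebesgue (- A) > 0" using assms(3) by (simp add: Compl_eq_Diff_UNIV)
      show False
      proof (rule closed_dyadic_limit_not_covered[OF assms(2) pos assms(7,8) s'(2,3)])
        fix c :: real
        assume c: "c > 0"
          "\<And>(U :: nat \<Rightarrow> (real ^ 'n) set) d. (\<And>i. d i > 0) \<Longrightarrow> (\<And>i x y. x \<in> U i \<Longrightarrow> y \<in> U i \<Longrightarrow> dist x y \<le> d i) \<Longrightarrow>
            summable (\<lambda>i. d i powr s') \<Longrightarrow> (\<Sum>i. d i powr s') < c \<Longrightarrow> \<not> closed_dyadic_limit \<alpha> \<subseteq> (\<Union>i. U i)"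
        \<comment> \<open>The cover of the level set is pushed forward by \<phi>; with bounds C * d
          i its sum grows by the factor \<open>C powr s'\<close>.\<close>
        have "c / C powr s' > 0" using c(1) C(1) by simp
        from hausdorff_measure_null_cover[OF s(3,2) s'(1,2) this]
        obtain U :: "nat \<Rightarrow> (real ^ 'n) set" and d :: "nat \<Rightarrow> real"
          where U: "?E \<subseteq> (\<Union>i. U i)" "\<And>i. d i > 0" "\<And>i x y. x \<in> U i \<Longrightarrow> y \<in> U i \<Longrightarrow> dist x y \<le> d i"
            "summable (\<lambda>i. d i powr s')" "(\<Sum>i. d i powr s') < c / C powr s'"
          by blast
        have powr: "(C * d i) powr s' = C powr s' * d i powr s'" for i
          using C(1) U(2)[of i] by (simp add: powr_mult)
        have "\<not> closed_dyadic_limit \<alpha> \<subseteq> (\<Union>i. \<phi> ` U i)"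
        proof (rule c(2))
          show "C * d i > 0" for i using C(1) U(2)[of i] by simp
          show "dist x y \<le> C * d i" if xy: "x \<in> \<phi> ` U i" "y \<in> \<phi> ` U i" for i x y
          proof -
            obtain u v where uv: "x = \<phi> u" "y = \<phi> v" "u \<in> U i" "v \<in> U i" using xy by blast
            have "C * dist u v \<le> C * d i" using U(3)[OF uv(3,4)] C(1) by (intro mult_left_mono) auto
            then show ?thesis using C(2)[of u v] uv by simp
          qed
          show "summable (\<lambda>i. (C * d i) powr s')" unfolding powr by (intro summable_mult U(4))
          have "(\<Sum>i. (C * d i) powr s') = C powr s' * (\<Sum>i. d i powr s')"
            unfolding powr by (rule suminf_mult[OF U(4)])
          also have "\<dots> < c" using U(5) C(1) by (simp add: less_divide_eq mult.commute)
          finally show "(\<Sum>i. (C * d i) powr s') < c" .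
        qed
        then obtain y where y: "y \<in> closed_dyadic_limit \<alpha>" "\<And>i. y \<notin> \<phi> ` U i" by blast
        obtain x where x: "y = \<phi> x" using surj by (metis surjD)
        have "x \<in> ?E" using E y(1) x by blast
        then show False using U(1) y(2) x by blast
      qed
    qed
    then show "of_nat CARD('n) \<le> b" using s(1) by (simp add: ennreal_of_nat_eq_real_of_nat ennreal_leI)
  qed
qed

end
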